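(* Let $\psi\in L^2(\mathbb R)$ be band-limited, with $\operatorname{supp}\widehat{\psi}\subset[-\rho,\rho]$ for some $\rho\in\,]0,+\infty[$. For $(j,k)\in\mathbb Z^2$ let $\psi_{j,k}\colon t\mapsto2^{j/2}\psi(2^jt-k)$. Suppose that $(\psi_{j,k})_{(j,k)\in\mathbb Z^2}$ is a frame for $L^2(\mathbb R)$, i.e., there exist constants $\alpha,\beta\in\,]0,+\infty[$ such that $$\big(\forall x\in L^2(\mathbb R)\big)\quad\alpha\|x\|^2\le\sum_{j\in\mathbb Z}\sum_{k\in\mathbb Z}|\langle x\mid\psi_{j,k}\rangle|^2\le\beta\|x\|^2,$$ and, moreover, that $(\psi_{j,k})_{(j,k)\in\mathbb Z^2}$ admits a lower Riesz bound $\gamma\in\,]0,+\infty[$, i.e., $$\big(\forall(c_{j,k})_{(j,k)\in\mathbb Z^2}\in\ell^2(\mathbb Z^2)\big)\quad\sum_{j\in\mathbb Z}\sum_{k\in\mathbb Z}|c_{j,k}|^2\le\gamma\Big\|\sum_{j\in\mathbb Z}\sum_{k\in\mathbb Z}c_{j,k}\psi_{j,k}\Big\|^2.$$ Let $A$ be a measurable subset of $\mathbb R$ such that $0<\mu(A)<+\infty$, let $J\in\mathbb Z$, and set $\Lambda=\{(j,k)\in\mathbb Z\times\mathbb Z : j\le J\}$. Then, for every $y\in L^2(A)$ and every $(\eta_{j,k})_{(j,k)\in\Lambda}\in\ell^2(\Lambda)$, there exists $x\in L^2(\mathbb R)$ such that $$x|_A=y\quad\text{and}\quad(\forall(j,k)\in\Lambda)\quad\langle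 x\mid\psi_{j,k}\rangle=\eta_{j,k}.$$
   Context: $\mu$ is Lebesgue measure on $\mathbb R$. $L^2(\mathbb R)$ is the space of (real- or complex-valued) square-integrable functions on $\mathbb R$, with its usual scalar product $\langle\cdot\mid\cdot\rangle$ and norm $\|\cdot\|$; $\widehat{x}$ is the Fourier transform of $x$ and $\operatorname{supp}\widehat{x}$ its support. The equality $x|_A=y$ is understood almost everywhere on $A$. *)

theory Defs
  imports "HOL-Analysis.Analysis"
begin

text \<open>
  Throughout, \<open>K\<close> is the scalar field, viewed as a set of complex numbers: \<open>K = \<real>\<close> gives the
  real spaces and \<open>K = UNIV\<close> the complex ones. Elements of the function spaces are represented by
  functions rather than by classes modulo equality almost everywhere.
\<close>

definition L2 :: "complex set \<Rightarrow> real measure \<Rightarrow> (real \<Rightarrow> complex) set" where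
  "L2 K M = {f. f \<in> borel_measurable M \<and> (\<forall>t\<in>space M. f t \<in> K)
                \<and> integrable M (\<lambda>t. (norm (f t))\<^sup>2)}"

definition L2_inner :: "(real \<Rightarrow> complex) \<Rightarrow> (real \<Rightarrow> complex) \<Rightarrow> complex" where
  "L2_inner x y = (LINT t|lebesgue. x t * cnj (y t))"

definition L2_norm :: "(real \<Rightarrow> complex) \<Rightarrow> real" where
  "L2_norm x = sqrt (LINT t|lebesgue. (norm (x t))\<^sup>2)"

text \<open>
  Convergence in \<open>L\<^sup>2\<close> norm. The nonnegative integral is used because, unlike the Bochner integral,
  it does not default to zero on functions that are not square-integrable.
\<close>

definition L2_tendsto :: "('i \<Rightarrow> real \<Rightarrow> complex) \<Rightarrow> (real \<Rightarrow> complex) \<Rightarrow> 'i filter \<Rightarrow> bool" where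
  "L2_tendsto f g F \<longleftrightarrow>
     ((\<lambda>i. \<integral>\<^sup>+ t. ennreal ((norm (f i t - g t))\<^sup>2) \<partial>lebesgue) \<longlongrightarrow> 0) F"

text \<open>Unconditional convergence of a series in \<open>L\<^sup>2\<close>; compare \<^const>\<open>has_sum\<close>.\<close>

definition has_L2_sum :: "('i \<Rightarrow> real \<Rightarrow> complex) \<Rightarrow> (real \<Rightarrow> complex) \<Rightarrow> 'i set \<Rightarrow> bool" where
  "has_L2_sum f s I \<longleftrightarrow> L2_tendsto (\<lambda>F t. \<Sum>i\<in>F. f i t) s (finite_subsets_at_top I)"

definition ell2 :: "complex set \<Rightarrow> 'i set \<Rightarrow> ('i \<Rightarrow> complex) set" where
  "ell2 K I = {c. (\<forall>i\<in>I. c i \<in> K) \<and> (\<lambda>i. (norm (c i))\<^sup>2) summable_on I}"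

text \<open>
  The Fourier(-Plancherel) transform on \<open>L\<^sup>2\<close>: \<open>h\<close> is the limit in \<open>L\<^sup>2\<close> of the Fourier integrals
  of the truncations of \<open>f\<close> to \<open>[-R, R]\<close>. By Plancherel's theorem such an \<open>h\<close> exists for every
  square-integrable \<open>f\<close>, and it is unique up to equality almost everywhere.
\<close>

definition has_fourier_transform :: "(real \<Rightarrow> complex) \<Rightarrow> (real \<Rightarrow> complex) \<Rightarrow> bool" where
  "has_fourier_transform f h \<longleftrightarrow> h \<in> L2 UNIV lebesgue \<and>
     L2_tendsto (\<lambda>R \<xi>. LINT t:{-R..R}|lebesgue. f t * cis (- (2 * pi * \<xi> * t))) h at_top"

text \<open>
  The support of a function defined up to equality almost everywhere: the complement of the union
  of all open sets on which it vanishes almost everywhere.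
\<close>

definition ess_support :: "(real \<Rightarrow> complex) \<Rightarrow> real set" where
  "ess_support h = - \<Union>{U. open U \<and> (AE t in lebesgue. t \<in> U \<longrightarrow> h t = 0)}"

definition wavelet :: "(real \<Rightarrow> complex) \<Rightarrow> int \<times> int \<Rightarrow> real \<Rightarrow> complex" where
  "wavelet \<psi> = (\<lambda>(j, k) t. of_real (2 powr (real_of_int j / 2)) * \<psi> (2 powi j * t - real_of_int k))"

definition frame_bounds ::
    "complex set \<Rightarrow> ('i \<Rightarrow> real \<Rightarrow> complex) \<Rightarrow> real \<Rightarrow> real \<Rightarrow> bool" where
  "frame_bounds K e \<alpha> \<beta> \<longleftrightarrow>
     (\<forall>x\<in>L2 K lebesgue.
        (\<lambda>i. (norm (L2_inner x (e i)))\<^sup>2) summable_on UNIV \<and>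
        \<alpha> * (L2_norm x)\<^sup>2 \<le> (\<Sum>\<^sub>\<infinity>i. (norm (L2_inner x (e i)))\<^sup>2) \<and>
        (\<Sum>\<^sub>\<infinity>i. (norm (L2_inner x (e i)))\<^sup>2) \<le> \<beta> * (L2_norm x)\<^sup>2)"

text \<open>
  Below, \<open>s\<close> is the sum of the series with terms \<open>c i * e i\<close>. For a family with an upper frame bound
  this series converges unconditionally for every \<open>c\<close> in \<^term>\<open>ell2 K UNIV\<close>, so that \<open>s\<close> exists,
  and it is unique up to equality almost everywhere.
\<close>

definition lower_riesz_bound ::
    "complex set \<Rightarrow> ('i \<Rightarrow> real \<Rightarrow> complex) \<Rightarrow> real \<Rightarrow> bool" where
  "lower_riesz_bound K e \<gamma> \<longleftrightarrow>
     (\<forall>c\<in>ell2 K UNIV. \<forall>s\<in>L2 K lebesgue. has_L2_sum (\<lambda>i t. c i * e i t) s UNIV \<longrightarrow>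
        (\<Sum>\<^sub>\<infinity>i. (norm (c i))\<^sup>2) \<le> \<gamma> * (L2_norm s)\<^sup>2)"

end

theory Submission
  imports Defs "HOL-Complex_Analysis.Great_Picard" "HOL-Probability.Sinc_Integral"
    "HOL-Real_Asymp.Real_Asymp"
begin

text \<open>
  Let \<open>B = 2 powi J * \<rho>\<close>. Dilating by \<open>2 powi j\<close> multiplies frequencies by the same factor, so the
  wavelets with \<open>j \<le> J\<close>, and their finite linear combinations \<open>v\<close>, all have their frequencies in
  \<open>[-B, B]\<close>. Two facts carry the proof.

  The first is that such \<open>v\<close> cannot concentrate on \<open>A\<close>: for some \<open>\<delta> > 0\<close>, independent of \<open>v\<close>, at
  least the fraction \<open>\<delta>\<close> of the energy of \<open>v\<close> lies outside \<open>A\<close> (\<open>band_limited_concentration_gap\<close>).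
  The reason is compactness together with analyticity. Band-limited functions of norm one extend to
  entire functions which are bounded uniformly on horizontal strips. If the fraction could be
  arbitrarily small, Montel's theorem would give a limit of such functions that is entire, has norm
  one on \<open>A\<close> (by dominated convergence, as \<open>A\<close> has finite measure) and vanishes almost everywhere
  outside \<open>A\<close> (by Fatou's lemma). As the complement of \<open>A\<close> has positive measure, the limit has
  uncountably many zeros, so it is zero: a contradiction. Consequently the lower Riesz bound survives,
  with a worse constant, when the wavelets with \<open>j \<le> J\<close> are restricted to the complement of \<open>A\<close>.

  The second fact is abstract: if a family has an upper frame bound and its restriction to a set
  \<open>E\<close> has a lower Riesz bound, then every square-summable family of prescribed scalar products is
  attained by a function that vanishes outside \<open>E\<close> (\<open>moment_problem_solvable\<close>). The function is built by
  successive approximation; each step takes a multiple of a finite combination of the restricted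
  family and shrinks the squared norm of the residual by a fixed factor. With \<open>E\<close> the complement of
  \<open>A\<close>, and the scalar products \<open>\<eta> i\<close> corrected by those of \<open>y\<close> extended by zero, this
  yields \<open>w\<close> such that \<open>y + w\<close> is the required function.

  The Fourier transform enters through a single formula: convolving \<open>f\<close> with the sinc kernel of
  bandwidth \<open>\<omega>\<close> cuts its transform off at frequency \<open>\<omega>\<close> (\<open>fourier_transform_sinc_kernel\<close>). If the
  transform of \<open>f\<close> vanishes outside \<open>[-\<rho>, \<rho>]\<close>, the result is one and the same entire function \<open>g\<close> for all
  \<open>\<omega> \<ge> \<rho>\<close>. Letting \<open>\<omega>\<close> tend to infinity, after integration over an arbitrary interval, shows that
  \<open>f = g\<close> almost everywhere (\<open>band_limited_inversion\<close>), and Cauchy-Schwarz applied to the same formula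
  bounds \<open>g\<close> on horizontal strips by the norm of \<open>f\<close>.
\<close>

section \<open>Square-integrable functions and real or complex scalars\<close>

lemma L2_mono: "L2 K M \<subseteq> L2 UNIV M"
  by (auto simp: L2_def)

lemma L2_measurable: "f \<in> L2 K M \<Longrightarrow> f \<in> borel_measurable M"
  by (simp add: L2_def)

lemma L2_integrable_norm_sq: "f \<in> L2 K M \<Longrightarrow> integrable M (\<lambda>t. (norm (f t))\<^sup>2)"
  by (simp add: L2_def)

lemma L2_I_bound:
  assumes "f \<in> borel_measurable M" "\<And>t. t \<in> space M \<Longrightarrow> f t \<in> K"
    and "integrable M g" "AE t in M. (norm (f t))\<^sup>2 \<le> g t"
  shows "f \<in> L2 K M"
  unfolding L2_def
proof (intro CollectI conjI ballI assms(1,2))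
  have [measurable]: "f \<in> borel_measurable M" by fact
  show "integrable M (\<lambda>t. (norm (f t))\<^sup>2)"
    by (rule Bochner_Integration.integrable_bound[OF assms(3)]) (use assms(4) in \<open>auto elim!: AE_mp\<close>)
qed

lemma norm_mult_le_sum_squares:
  fixes a b :: complex
  shows "norm (a * b) \<le> (norm a)\<^sup>2 + (norm b)\<^sup>2"
proof -
  have "2 * (norm a * norm b) \<le> (norm a)\<^sup>2 + (norm b)\<^sup>2"
    using sum_squares_bound[of "norm a" "norm b"] by simp
  moreover have "0 \<le> norm a * norm b" by simp
  ultimately show ?thesis unfolding norm_mult by linarith
qed

text \<open>
  The weight \<open>s\<close> lets one summand keep a factor as close to 1 as desired; a residual that has been
  contracted may then be perturbed slightly without losing the contraction.
\<close>

lemma norm_add_sq_le_weighted: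
  fixes x y :: complex
  assumes "0 < s"
  shows "(norm (x + y))\<^sup>2 \<le> (1 + s) * (norm x)\<^sup>2 + (1 + 1 / s) * (norm y)\<^sup>2"
proof -
  have "0 \<le> (sqrt s * norm x - norm y / sqrt s)\<^sup>2" by simp
  also have "\<dots> = s * (norm x)\<^sup>2 - 2 * (norm x * norm y) + 1 / s * (norm y)\<^sup>2"
    using assms by (simp add: power2_diff power_mult_distrib power_divide)
  finally have "2 * (norm x * norm y) \<le> s * (norm x)\<^sup>2 + 1 / s * (norm y)\<^sup>2" by simp
  moreover have "(norm (x + y))\<^sup>2 \<le> (norm x + norm y)\<^sup>2"
    by (intro power_mono norm_triangle_ineq) simp
  ultimately show ?thesis by (simp add: power2_sum distrib_right)
qed

lemma norm_add_sq_le: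
  fixes a b :: complex
  shows "(norm (a + b))\<^sup>2 \<le> 2 * (norm a)\<^sup>2 + 2 * (norm b)\<^sup>2"
  using norm_add_sq_le_weighted[of 1 a b] by simp

lemma L2_mult_integrable:
  assumes "f \<in> L2 K M" "g \<in> L2 K' M"
  shows "integrable M (\<lambda>t. f t * g t)"
proof (rule Bochner_Integration.integrable_bound)
  show "integrable M (\<lambda>t. (norm (f t))\<^sup>2 + (norm (g t))\<^sup>2)"
    using assms by (intro Bochner_Integration.integrable_add L2_integrable_norm_sq)
  show "(\<lambda>t. f t * g t) \<in> borel_measurable M"
    using assms L2_measurable by (intro borel_measurable_times) blast+
  show "AE t in M. norm (f t * g t) \<le> norm ((norm (f t))\<^sup>2 + (norm (g t))\<^sup>2)"
    using norm_mult_le_sum_squares by (auto intro!: order_trans[OF norm_mult_le_sum_squares])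
qed

lemma L2_cnj: "f \<in> L2 UNIV M \<Longrightarrow> (\<lambda>t. cnj (f t)) \<in> L2 UNIV M"
  by (auto simp: L2_def intro!: borel_measurable_continuous_on[where f = cnj] continuous_intros)

lemma L2_add: "f \<in> L2 UNIV M \<Longrightarrow> g \<in> L2 UNIV M \<Longrightarrow> (\<lambda>t. f t + g t) \<in> L2 UNIV M"
  by (rule L2_I_bound[where g = "\<lambda>t. 2 * (norm (f t))\<^sup>2 + 2 * (norm (g t))\<^sup>2"])
     (auto simp: norm_add_sq_le L2_def)

lemma L2_cmult: "f \<in> L2 UNIV M \<Longrightarrow> (\<lambda>t. c * f t) \<in> L2 UNIV M"
  by (auto simp: L2_def norm_mult power_mult_distrib)

lemma L2_sum:
  "(\<And>i. i \<in> I \<Longrightarrow> f i \<in> L2 UNIV M) \<Longrightarrow> (\<lambda>t. \<Sum>i\<in>I. f i t) \<in> L2 UNIV M"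
proof (induction I rule: infinite_finite_induct)
  case (insert i I)
  then show ?case by (auto intro!: L2_add)
qed (auto simp: L2_def)

lemma L2_restrict:
  assumes "f \<in> L2 K M" "S \<in> sets M" "0 \<in> K"
  shows "(\<lambda>t. indicator S t * f t) \<in> L2 K M"
proof (rule L2_I_bound[where g = "\<lambda>t. (norm (f t))\<^sup>2"])
  have [measurable]: "f \<in> borel_measurable M" "S \<in> sets M"
    using assms by (auto simp: L2_def)
  show "(\<lambda>t. indicator S t * f t) \<in> borel_measurable M" by measurable
qed (use assms in \<open>auto simp: L2_def indicator_def\<close>)

lemma Cauchy_Schwarz_L2:
  fixes f g :: "real \<Rightarrow> complex"
  assumes f: "f \<in> L2 UNIV M" and g: "g \<in> L2 UNIV M"
  shows "(norm (LINT t|M. f t * g t))\<^sup>2 \<le> (LINT t|M. (norm (f t))\<^sup>2) * (LINT t|M. (norm (g t))\<^sup>2)"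
proof -
  have [measurable]: "f \<in> borel_measurable M" "g \<in> borel_measurable M"
    using f g by (auto simp: L2_def)
  have fi: "integrable M (\<lambda>t. (norm (f t))\<^sup>2)" and gi: "integrable M (\<lambda>t. (norm (g t))\<^sup>2)"
    and fgi: "integrable M (\<lambda>t. f t * g t)"
    using f g by (auto simp: L2_def intro: L2_mult_integrable[OF f g])
  let ?I = "LINT t|M. norm (f t * g t)"
  have "ennreal (?I\<^sup>2) = (\<integral>\<^sup>+t. ennreal (norm (f t * g t)) \<partial>M)\<^sup>2"
    using nn_integral_eq_integral[OF integrable_norm[OF fgi]] by (simp add: ennreal_power)
  also have "\<dots> = (\<integral>\<^sup>+t. ennreal (norm (f t)) * ennreal (norm (g t)) \<partial>M)\<^sup>2"
    by (simp add: norm_mult ennreal_mult)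
  also have "\<dots> \<le> (\<integral>\<^sup>+t. (ennreal (norm (f t)))\<^sup>2 \<partial>M) * (\<integral>\<^sup>+t. (ennreal (norm (g t)))\<^sup>2 \<partial>M)"
    by (rule Cauchy_Schwarz_nn_integral) auto
  also have "\<dots> = ennreal ((LINT t|M. (norm (f t))\<^sup>2) * (LINT t|M. (norm (g t))\<^sup>2))"
    using nn_integral_eq_integral[OF fi] nn_integral_eq_integral[OF gi]
    by (simp add: ennreal_power ennreal_mult)
  finally have "?I\<^sup>2 \<le> (LINT t|M. (norm (f t))\<^sup>2) * (LINT t|M. (norm (g t))\<^sup>2)"
    by (simp add: ennreal_le_iff)
  moreover have "(norm (LINT t|M. f t * g t))\<^sup>2 \<le> ?I\<^sup>2"
    by (intro power_mono integral_norm_bound) auto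
  ultimately show ?thesis by linarith
qed

definition scalar_field :: "complex set \<Rightarrow> bool" where
  "scalar_field K \<longleftrightarrow> K = \<real> \<or> K = UNIV"

lemma scalar_field_closed:
  assumes "scalar_field K"
  shows scalar_field_of_real: "of_real x \<in> K"
    and scalar_field_0: "0 \<in> K"
    and scalar_field_add: "a \<in> K \<Longrightarrow> b \<in> K \<Longrightarrow> a + b \<in> K"
    and scalar_field_diff: "a \<in> K \<Longrightarrow> b \<in> K \<Longrightarrow> a - b \<in> K"
    and scalar_field_mult: "a \<in> K \<Longrightarrow> b \<in> K \<Longrightarrow> a * b \<in> K"
    and scalar_field_cnj: "a \<in> K \<Longrightarrow> cnj a \<in> K"
    and scalar_field_closed_set: "closed K"
  using assms unfolding scalar_field_def
  by (auto simp: Reals_cnj_iff closed_complex_Reals)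

lemma scalar_field_sum:
  assumes "scalar_field K" "\<And>i. i \<in> I \<Longrightarrow> f i \<in> K"
  shows "sum f I \<in> K"
  using assms(2)
  by (induction I rule: infinite_finite_induct)
     (auto intro: scalar_field_0[OF assms(1)] scalar_field_add[OF assms(1)])

lemma scalar_field_integral:
  assumes "scalar_field K" "\<And>t. f t \<in> K"
  shows "(LINT t|M. f t) \<in> K"
proof (cases "K = \<real>")
  case True
  then have "f = (\<lambda>t. complex_of_real (Re (f t)))" using assms(2) by auto
  then have "(LINT t|M. f t) = complex_of_real (LINT t|M. Re (f t))"
    by (metis integral_complex_of_real)
  then show ?thesis using True by simp
qed (use assms in \<open>simp add: scalar_field_def\<close>)

lemma L2_scalars_iff: "f \<in> L2 K M \<longleftrightarrow> f \<in> L2 UNIV M \<and> (\<forall>t\<in>space M. f t \<in> K)"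
  by (auto simp: L2_def)

lemma L2_inner_scalar:
  assumes "scalar_field K" "x \<in> L2 K lebesgue" "y \<in> L2 K lebesgue"
  shows "L2_inner x y \<in> K"
  unfolding L2_inner_def
  using assms(2,3) by (intro scalar_field_integral[OF assms(1)] scalar_field_mult[OF assms(1)] scalar_field_cnj[OF assms(1)])
    (auto simp: L2_def)

lemma L2_inner_integrable:
  "x \<in> L2 UNIV lebesgue \<Longrightarrow> y \<in> L2 UNIV lebesgue \<Longrightarrow> integrable lebesgue (\<lambda>t. x t * cnj (y t))"
  by (rule L2_mult_integrable[OF _ L2_cnj])

lemma L2_inner_sum_left:
  assumes "\<And>i. i \<in> I \<Longrightarrow> x i \<in> L2 UNIV lebesgue" "y \<in> L2 UNIV lebesgue"
  shows "L2_inner (\<lambda>t. \<Sum>i\<in>I. x i t) y = (\<Sum>i\<in>I. L2_inner (x i) y)"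
  unfolding L2_inner_def sum_distrib_right
  by (rule Bochner_Integration.integral_sum) (intro L2_inner_integrable assms)

lemma L2_inner_sum_right:
  assumes "\<And>i. i \<in> I \<Longrightarrow> y i \<in> L2 UNIV lebesgue" "x \<in> L2 UNIV lebesgue"
  shows "L2_inner x (\<lambda>t. \<Sum>i\<in>I. c i * y i t) = (\<Sum>i\<in>I. cnj (c i) * L2_inner x (y i))"
proof -
  have "L2_inner x (\<lambda>t. \<Sum>i\<in>I. c i * y i t) = (LINT t|lebesgue. (\<Sum>i\<in>I. cnj (c i) * (x t * cnj (y i t))))"
    unfolding L2_inner_def by (simp add: sum_distrib_left mult_ac)
  also have "\<dots> = (\<Sum>i\<in>I. (LINT t|lebesgue. cnj (c i) * (x t * cnj (y i t))))"
    by (rule Bochner_Integration.integral_sum) (intro integrable_mult_right L2_inner_integrable assms)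
  finally show ?thesis by (simp add: L2_inner_def)
qed

lemma L2_inner_cmult_left: "L2_inner (\<lambda>t. c * x t) y = c * L2_inner x y"
  by (simp add: L2_inner_def mult.assoc)

lemma L2_norm_sq: "(L2_norm x)\<^sup>2 = (LINT t|lebesgue. (norm (x t))\<^sup>2)"
  by (simp add: L2_norm_def)

section \<open>Absolutely convergent series of square-integrable functions\<close>

lemma weighted_Cauchy_Schwarz:
  fixes b :: "nat \<Rightarrow> real"
  assumes "0 < p" "p < 1" "summable (\<lambda>n. (b n)\<^sup>2 / p ^ n)" "finite I"
  shows "(\<Sum>i\<in>I. b i)\<^sup>2 \<le> 1 / (1 - p) * (\<Sum>n. (b n)\<^sup>2 / p ^ n)"
proof -
  have "(\<Sum>i\<in>I. b i)\<^sup>2 = (\<Sum>i\<in>I. sqrt (p ^ i) * (b i / sqrt (p ^ i)))\<^sup>2"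
    using assms(1) by simp
  also have "\<dots> \<le> (\<Sum>i\<in>I. (sqrt (p ^ i))\<^sup>2) * (\<Sum>i\<in>I. (b i / sqrt (p ^ i))\<^sup>2)"
    by (rule Cauchy_Schwarz_ineq_sum)
  also have "\<dots> = (\<Sum>i\<in>I. p ^ i) * (\<Sum>i\<in>I. (b i)\<^sup>2 / p ^ i)"
    using assms(1) by (simp add: power_divide)
  also have "\<dots> \<le> 1 / (1 - p) * (\<Sum>n. (b n)\<^sup>2 / p ^ n)"
  proof (rule mult_mono)
    show "(\<Sum>i\<in>I. p ^ i) \<le> 1 / (1 - p)"
      using sum_le_suminf[of "\<lambda>i. p ^ i" I] suminf_geometric[of p] assms by (auto simp: summable_geometric)
    show "(\<Sum>i\<in>I. (b i)\<^sup>2 / p ^ i) \<le> (\<Sum>n. (b n)\<^sup>2 / p ^ n)"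
      using assms by (intro sum_le_suminf) auto
  qed (use assms in \<open>auto intro!: sum_nonneg\<close>)
  finally show ?thesis .
qed

text \<open>
  If the squared norms of \<open>z n\<close> decay like \<open>q ^ n\<close>, then with \<open>p = sqrt q\<close> the sum of the
  \<open>\<bar>z n\<bar>\<^sup>2 / p ^ n\<close> is integrable, and by the weighted Cauchy-Schwarz inequality a constant multiple
  \<open>Q\<close> of it bounds the square of every partial sum. So the series converges almost everywhere,
  and dominated convergence allows scalar products to be computed term by term.
\<close>

lemma L2_geometric_series:
  assumes K: "scalar_field K" and z: "\<And>n. z n \<in> L2 K lebesgue"
    and bound: "\<And>n. (LINT t|lebesgue. (norm (z n t))\<^sup>2) \<le> C * q ^ n" and q: "0 < q" "q < 1"
  shows "\<exists>w\<in>L2 K lebesgue. (\<forall>t. (\<forall>n. z n t = 0) \<longrightarrow> w t = 0) \<and>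
           (\<forall>e\<in>L2 UNIV lebesgue. (\<lambda>n. L2_inner (z n) e) sums L2_inner w e)"
proof -
  \<comment> \<open>Any ratio strictly between \<open>q\<close> and 1 would do; with this one \<open>q / p = p\<close>.\<close>
  define p where "p = sqrt q"
  have p: "0 < p" "p < 1" "q = p * p" using q by (auto simp: p_def)
  have z': "z n \<in> L2 UNIV lebesgue" for n using z L2_mono by blast
  have [measurable]: "z n \<in> borel_measurable lebesgue" for n using z by (rule L2_measurable)
  define u where "u n t = (norm (z n t))\<^sup>2 / p ^ n" for n t
  have u_nonneg: "0 \<le> u n t" for n t using p by (simp add: u_def)
  have u_int: "integrable lebesgue (u n)" for n
    unfolding u_def divide_inverse by (intro integrable_mult_left L2_integrable_norm_sq[OF z])
  have u_le: "(LINT t|lebesgue. u n t) \<le> C * p ^ n" for n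
    using bound[of n] p by (simp add: u_def divide_le_eq power_mult_distrib mult_ac)
  have "summable (\<lambda>n. C * p ^ n)" using p by (intro summable_mult summable_geometric) simp
  then have u_summable: "summable (\<lambda>n. LINT t|lebesgue. u n t)"
    by (rule summable_comparison_test'[where N = 0])
       (use u_le in \<open>auto simp: u_nonneg intro: Bochner_Integration.integral_nonneg\<close>)
  \<comment> \<open>Off \<open>S\<close>, a null set, the sum is set to zero, since an arbitrary default need not be a scalar.\<close>
  define S where "S = {t. (\<Sum>n. ennreal (u n t)) \<noteq> top}"
  have S: "summable (\<lambda>n. u n t)" if "t \<in> S" for t
    using that unfolding S_def by (intro summable_suminf_not_top u_nonneg) auto
  have [measurable]: "u n \<in> borel_measurable lebesgue" for n unfolding u_def by measurable
  have "{t \<in> space lebesgue. (\<Sum>n. ennreal (u n t)) \<noteq> top} \<in> sets lebesgue" by measurable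
  then have S_meas [measurable]: "S \<in> sets lebesgue" by (simp add: S_def)
  have AE_S: "AE t in lebesgue. t \<in> S"
  proof -
    have "(\<integral>\<^sup>+t. (\<Sum>n. ennreal (u n t)) \<partial>lebesgue) = (\<Sum>n. \<integral>\<^sup>+t. ennreal (u n t) \<partial>lebesgue)"
      by (rule nn_integral_suminf) measurable
    also have "\<dots> = (\<Sum>n. ennreal (LINT t|lebesgue. u n t))"
      using nn_integral_eq_integral[OF u_int] u_nonneg by simp
    also have "\<dots> = ennreal (\<Sum>n. (LINT t|lebesgue. u n t))"
      by (rule suminf_ennreal2[OF _ u_summable]) (simp add: u_nonneg)
    finally have "(\<integral>\<^sup>+t. (\<Sum>n. ennreal (u n t)) \<partial>lebesgue) \<noteq> \<infinity>" by simp
    then have "AE t in lebesgue. (\<Sum>n. ennreal (u n t)) \<noteq> \<infinity>"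
      by (intro nn_integral_noteq_infinite) measurable
    then show ?thesis by eventually_elim (simp add: S_def)
  qed
  define Q where "Q t = 1 / (1 - p) * (\<Sum>n. u n t)" for t
  have Q_int: "integrable lebesgue Q"
    unfolding Q_def
  proof (intro integrable_mult_right integrable_suminf u_int)
    show "AE t in lebesgue. summable (\<lambda>n. norm (u n t))"
      using AE_S by eventually_elim (use S u_nonneg in simp)
    show "summable (\<lambda>n. LINT t|lebesgue. norm (u n t))"
      using u_summable u_nonneg by simp
  qed
  have partial: "(\<Sum>i\<in>I. norm (z i t))\<^sup>2 \<le> Q t" if "t \<in> S" "finite I" for I t
    using weighted_Cauchy_Schwarz[OF p(1,2) _ that(2), of "\<lambda>n. norm (z n t)"] S[OF that(1)]
    unfolding Q_def u_def by simp
  have z_summable: "summable (\<lambda>n. norm (z n t))" if "t \<in> S" for t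
  proof (rule summable_comparison_test'[where N = 0])
    show "summable (\<lambda>n. p ^ n + u n t)"
      using p by (intro summable_add summable_geometric S that) simp
    show "norm (norm (z n t)) \<le> p ^ n + u n t" for n
    proof (cases "norm (z n t) \<le> p ^ n")
      case True then show ?thesis using u_nonneg[of n t] by simp
    next
      case False
      then have "p ^ n * norm (z n t) \<le> norm (z n t) * norm (z n t)" by (intro mult_right_mono) auto
      then have "norm (z n t) \<le> u n t" using p by (simp add: u_def field_simps power2_eq_square)
      then show ?thesis using p by (simp add: add_increasing)
    qed
  qed
  define w where "w t = (if t \<in> S then \<Sum>n. z n t else 0)" for t
  have w_sums: "(\<lambda>n. z n t) sums w t" if "t \<in> S" for t
    using summable_norm_cancel[OF z_summable[OF that]] that by (simp add: w_def summable_sums)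
  have sum_le: "(norm (\<Sum>i<n. z i t))\<^sup>2 \<le> Q t" if "t \<in> S" for n t
    using partial[OF that, of "{..<n}"] power_mono[OF norm_sum[of "\<lambda>i. z i t" "{..<n}"], of 2] by simp
  have w_le: "(norm (w t))\<^sup>2 \<le> Q t" if "t \<in> S" for t
  proof (rule LIMSEQ_le_const2)
    show "(\<lambda>n. (norm (\<Sum>i<n. z i t))\<^sup>2) \<longlonglongrightarrow> (norm (w t))\<^sup>2"
      using w_sums[OF that] unfolding sums_def by (intro tendsto_intros)
  qed (use sum_le[OF that] in auto)
  have w_meas: "w \<in> borel_measurable lebesgue" unfolding w_def by measurable
  have w_K: "w t \<in> K" for t
  proof (cases "t \<in> S")
    case True
    have "z n t \<in> K" for n using z[of n] by (simp add: L2_def)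
    then have "(\<Sum>i<n. z i t) \<in> K" for n by (rule scalar_field_sum[OF K])
    then show ?thesis
      by (rule closed_sequentially[OF scalar_field_closed_set[OF K] _ w_sums[OF True, unfolded sums_def]])
  qed (simp add: w_def scalar_field_0[OF K])
  have w: "w \<in> L2 K lebesgue"
  proof (rule L2_I_bound[OF w_meas w_K Q_int])
    show "AE t in lebesgue. (norm (w t))\<^sup>2 \<le> Q t" using AE_S by eventually_elim (rule w_le)
  qed
  have "(\<lambda>n. L2_inner (z n) e) sums L2_inner w e" if e: "e \<in> L2 UNIV lebesgue" for e
  proof -
    have [measurable]: "e \<in> borel_measurable lebesgue" using e by (rule L2_measurable)
    have e_cnj: "(\<lambda>t. cnj (e t)) \<in> borel_measurable lebesgue" using L2_cnj[OF e] by (rule L2_measurable)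
    have "(\<lambda>n. LINT t|lebesgue. (\<Sum>i<n. z i t) * cnj (e t)) \<longlonglongrightarrow> (LINT t|lebesgue. w t * cnj (e t))"
    proof (rule integral_dominated_convergence)
      show "integrable lebesgue (\<lambda>t. Q t + (norm (e t))\<^sup>2)"
        by (intro Bochner_Integration.integrable_add Q_int L2_integrable_norm_sq[OF e])
      show "(\<lambda>t. w t * cnj (e t)) \<in> borel_measurable lebesgue"
        by (intro borel_measurable_times w_meas e_cnj)
      show "(\<lambda>t. (\<Sum>i<n. z i t) * cnj (e t)) \<in> borel_measurable lebesgue" for n
        by (intro borel_measurable_times borel_measurable_sum e_cnj) measurable
      show "AE t in lebesgue. (\<lambda>n. (\<Sum>i<n. z i t) * cnj (e t)) \<longlonglongrightarrow> w t * cnj (e t)"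
        using AE_S by eventually_elim (use w_sums in \<open>auto simp: sums_def intro!: tendsto_mult\<close>)
      show "AE t in lebesgue. norm ((\<Sum>i<n. z i t) * cnj (e t)) \<le> Q t + (norm (e t))\<^sup>2" for n
        using AE_S
      proof eventually_elim
        case (elim t)
        show ?case
          using norm_mult_le_sum_squares[of "\<Sum>i<n. z i t" "cnj (e t)"] sum_le[OF elim, of n]
          by (simp del: norm_mult)
      qed
    qed
    then show ?thesis
      using L2_inner_sum_left[of "{..<_}" z, OF z' e] by (simp add: sums_def L2_inner_def)
  qed
  moreover have "\<forall>t. (\<forall>n. z n t = 0) \<longrightarrow> w t = 0" by (simp add: w_def)
  ultimately show ?thesis using w by blast
qed

section \<open>The sinc kernel\<close>

lemma borel_imp_lebesgue_measurable:
  "f \<in> borel_measurable borel \<Longrightarrow> f \<in> borel_measurable lebesgue"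
  by (rule measurable_completion) simp

lemma sigma_finite_lebesgue: "sigma_finite_measure (lebesgue :: real measure)"
proof
  obtain \<A> :: "real set set" where "countable \<A>" "\<A> \<subseteq> sets lborel" "\<Union>\<A> = space lborel"
      "\<forall>a\<in>\<A>. emeasure lborel a \<noteq> \<infinity>"
    using sigma_finite_measure.sigma_finite_countable[OF sigma_finite_lborel] by metis
  then show "\<exists>\<A>::real set set. countable \<A> \<and> \<A> \<subseteq> sets lebesgue \<and> \<Union>\<A> = space lebesgue
      \<and> (\<forall>a\<in>\<A>. emeasure lebesgue a \<noteq> \<infinity>)"
    by (intro exI[of _ \<A>]) auto
qed

lemma pair_sigma_finite_lebesgue: "pair_sigma_finite (lebesgue :: real measure) (lebesgue :: real measure)"
  by (intro pair_sigma_finite.intro sigma_finite_lebesgue)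

lemma of_real_measurable_lebesgue: "complex_of_real \<in> borel_measurable lebesgue"
  by (rule borel_imp_lebesgue_measurable) measurable

lemma of_real_fst_measurable:
  "(\<lambda>p. complex_of_real (fst p)) \<in> borel_measurable (lebesgue \<Otimes>\<^sub>M M)"
  by (rule measurable_compose[OF measurable_fst of_real_measurable_lebesgue])

lemma of_real_snd_measurable:
  "(\<lambda>p. complex_of_real (snd p)) \<in> borel_measurable (M \<Otimes>\<^sub>M lebesgue)"
  by (rule measurable_compose[OF measurable_snd of_real_measurable_lebesgue])

text \<open>
  The inverse Fourier transform of the indicator function of \<open>[-\<omega>, \<omega>]\<close>, on the whole complex plane.
\<close>

definition sinc_kernel :: "real \<Rightarrow> complex \<Rightarrow> complex" where
  "sinc_kernel \<omega> w = (if w = 0 then 2 * of_real \<omega> else sin (2 * of_real pi * of_real \<omega> * w) / (of_real pi * w))"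

abbreviation exp_2pi_i :: "complex \<Rightarrow> complex" where
  "exp_2pi_i w \<equiv> exp (2 * of_real pi * \<i> * w)"

lemma norm_exp_2pi_i: "norm (exp_2pi_i (of_real \<xi> * w)) = exp (- (2 * pi * \<xi> * Im w))"
  by (simp add: norm_exp_eq_Re)

lemma sinc_kernel_eq_integral:
  assumes "0 \<le> \<omega>"
  shows "sinc_kernel \<omega> w = (LINT \<xi>:{-\<omega>..\<omega>}|lebesgue. exp_2pi_i (of_real \<xi> * w))"
proof -
  have cont: "continuous_on {-\<omega>..\<omega>} (\<lambda>\<xi>. exp_2pi_i (of_real \<xi> * w))"
    by (intro continuous_intros)
  have meas: "(\<lambda>\<xi>::real. indicator {-\<omega>..\<omega>} \<xi> *\<^sub>R exp_2pi_i (of_real \<xi> * w)) \<in> borel_measurable lborel"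
    by measurable
  define F where "F = (\<lambda>\<xi>::real. if w = 0 then complex_of_real \<xi> else exp_2pi_i (of_real \<xi> * w) / (2 * of_real pi * \<i> * w))"
  have deriv: "(F has_vector_derivative exp_2pi_i (of_real \<xi> * w)) (at \<xi> within {-\<omega>..\<omega>})" for \<xi>
  proof (cases "w = 0")
    case True
    then show ?thesis unfolding F_def
      by (auto intro!: derivative_eq_intros)
  next
    case False
    have "((\<lambda>\<xi>. exp_2pi_i (of_real \<xi> * w) / (2 * of_real pi * \<i> * w)) has_vector_derivative exp_2pi_i (of_real \<xi> * w)) (at \<xi>)"
      by (rule has_vector_derivative_real_field) (use False in \<open>auto intro!: derivative_eq_intros\<close>)
    then show ?thesis unfolding F_def using False by (simp add: has_vector_derivative_at_within)
  qed
  have "(LINT \<xi>:{-\<omega>..\<omega>}|lebesgue. exp_2pi_i (of_real \<xi> * w)) = F \<omega> - F (-\<omega>)"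
    unfolding set_lebesgue_integral_def integral_completion[OF meas]
    by (rule integral_FTC_Icc[OF _ deriv cont]) (use assms in auto)
  also have "\<dots> = sinc_kernel \<omega> w"
    by (simp add: F_def sinc_kernel_def sin_exp_eq field_simps exp_minus)
  finally show ?thesis by simp
qed

lemma sinc_kernel_scale: "c \<noteq> 0 \<Longrightarrow> of_real c * sinc_kernel \<omega> (of_real c * w) = sinc_kernel (c * \<omega>) w"
  by (simp add: sinc_kernel_def mult_ac)

lemma sinc_kernel_of_real:
  "sinc_kernel \<omega> (of_real x) = of_real (2 * \<omega> * (if 2 * pi * \<omega> * x = 0 then 1 else sin (2 * pi * \<omega> * x) / (2 * pi * \<omega> * x)))"
  by (auto simp: sinc_kernel_def simp flip: sin_of_real)

lemma exp_2pi_i_integrable_interval: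
  "set_integrable lebesgue {a..b} (\<lambda>\<xi>. exp_2pi_i (of_real \<xi> * w))"
proof -
  have "continuous_on {a..b} (\<lambda>\<xi>. exp_2pi_i (of_real \<xi> * w))"
    by (intro continuous_intros)
  from borel_integrable_compact[OF _ this] show ?thesis
    by (auto simp: set_integrable_def intro: integrable_completion[THEN iffD2])
qed

lemma norm_sinc_kernel_le:
  assumes "0 \<le> \<omega>"
  shows "norm (sinc_kernel \<omega> w) \<le> 2 * \<omega> * exp (2 * pi * \<omega> * \<bar>Im w\<bar>)"
proof -
  have le: "norm (exp_2pi_i (of_real \<xi> * w)) \<le> exp (2 * pi * \<omega> * \<bar>Im w\<bar>)" if "\<xi> \<in> {-\<omega>..\<omega>}" for \<xi>
  proof -
    have "- (\<xi> * Im w) \<le> \<bar>\<xi>\<bar> * \<bar>Im w\<bar>" by (metis abs_ge_minus_self abs_mult)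
    also have "\<dots> \<le> \<omega> * \<bar>Im w\<bar>" using that by (intro mult_right_mono) auto
    finally have "2 * pi * - (\<xi> * Im w) \<le> 2 * pi * (\<omega> * \<bar>Im w\<bar>)"
      by (intro mult_left_mono) auto
    then show ?thesis by (simp add: norm_exp_2pi_i mult_ac)
  qed
  have "norm (sinc_kernel \<omega> w) \<le> (LINT \<xi>:{-\<omega>..\<omega>}|lebesgue. norm (exp_2pi_i (of_real \<xi> * w)))"
    unfolding sinc_kernel_eq_integral[OF assms] set_lebesgue_integral_def
    by (rule order_trans[OF integral_norm_bound]) (simp add: norm_mult)
  also have "\<dots> \<le> (LINT \<xi>:{-\<omega>..\<omega>}|lebesgue. exp (2 * pi * \<omega> * \<bar>Im w\<bar>))"
  proof (rule set_integral_mono)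
    show "set_integrable lebesgue {-\<omega>..\<omega>} (\<lambda>\<xi>. norm (exp_2pi_i (of_real \<xi> * w)))"
      by (rule set_integrable_norm[OF exp_2pi_i_integrable_interval])
    show "set_integrable lebesgue {-\<omega>..\<omega>} (\<lambda>\<xi>. exp (2 * pi * \<omega> * \<bar>Im w\<bar>))"
      unfolding set_integrable_def
        by (intro integrable_scaleR_left integrable_real_indicator) (auto simp: emeasure_lborel_Icc_eq)
  qed (rule le)
  also have "\<dots> = 2 * \<omega> * exp (2 * pi * \<omega> * \<bar>Im w\<bar>)"
    using assms by (simp add: set_lebesgue_integral_def)
  finally show ?thesis .
qed

lemma norm_sin_le_exp: "norm (sin (w::complex)) \<le> exp \<bar>Im w\<bar>"
proof -
  have "norm (sin w) = norm (exp (\<i> * w) - exp (- (\<i> * w))) / 2"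
    by (simp add: sin_exp_eq norm_divide norm_mult)
  also have "\<dots> \<le> (norm (exp (\<i> * w)) + norm (exp (- (\<i> * w)))) / 2"
    by (intro divide_right_mono norm_triangle_ineq4) auto
  also have "\<dots> = (exp (- Im w) + exp (Im w)) / 2" by (simp add: norm_exp_eq_Re)
  also have "\<dots> \<le> (exp \<bar>Im w\<bar> + exp \<bar>Im w\<bar>) / 2"
    by (intro divide_right_mono add_mono) auto
  finally show ?thesis by simp
qed

text \<open>
  Near \<open>Re w = 0\<close> the bound comes from the integral representation, and for large
  \<open>Re w\<close> from the denominator of the closed form. This makes the kernel square-integrable along every
  horizontal line, locally uniformly in the height of the line.
\<close>

lemma norm_sinc_kernel_sq_le:
  assumes "0 \<le> \<omega>"
  shows "(norm (sinc_kernel \<omega> w))\<^sup>2 \<le> (4 * \<omega>\<^sup>2 + 1) * (exp (2 * pi * \<omega> * \<bar>Im w\<bar>))\<^sup>2 / (1 + (Re w)\<^sup>2)"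
proof -
  let ?E = "exp (2 * pi * \<omega> * \<bar>Im w\<bar>)"
  have 1: "(norm (sinc_kernel \<omega> w))\<^sup>2 \<le> 4 * \<omega>\<^sup>2 * ?E\<^sup>2"
    using power_mono[OF norm_sinc_kernel_le[OF assms, of w], of 2] by (simp add: power_mult_distrib)
  have "norm (sinc_kernel \<omega> w) * norm w \<le> ?E"
  proof (cases "w = 0")
    case False
    have "norm (sinc_kernel \<omega> w) * norm w = norm (sin (2 * of_real pi * of_real \<omega> * w)) / pi"
      using False by (simp add: sinc_kernel_def norm_divide norm_mult)
    also have "\<dots> \<le> norm (sin (2 * of_real pi * of_real \<omega> * w)) / 1"
      using pi_gt3 by (intro divide_left_mono) auto
    also have "\<dots> \<le> ?E"
      using norm_sin_le_exp[of "2 * of_real pi * of_real \<omega> * w"] assms by (simp add: abs_mult)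
    finally show ?thesis .
  qed auto
  then have "(norm (sinc_kernel \<omega> w) * \<bar>Re w\<bar>) \<le> ?E"
    by (rule order_trans[rotated]) (intro mult_left_mono abs_Re_le_cmod norm_ge_zero)
  then have 2: "(norm (sinc_kernel \<omega> w))\<^sup>2 * (Re w)\<^sup>2 \<le> ?E\<^sup>2"
    using power_mono[of "norm (sinc_kernel \<omega> w) * \<bar>Re w\<bar>" ?E 2] by (simp add: power_mult_distrib)
  have "0 < 1 + (Re w)\<^sup>2" by (simp add: add_pos_nonneg)
  then show ?thesis using 1 2 by (simp add: field_simps)
qed

lemma sinc_kernel_measurable [measurable]:
  "sinc_kernel \<omega> \<in> borel_measurable borel"
  unfolding sinc_kernel_def by measurable

lemma Cauchy_density_integrable:
  "integrable lebesgue (\<lambda>u::real. 1 / (1 + (x - u)\<^sup>2))"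
  and Cauchy_density_integral:
  "(LINT u|lebesgue. 1 / (1 + (x - u)\<^sup>2)) = pi"
proof -
  have meas: "(\<lambda>u::real. 1 / (1 + u\<^sup>2)) \<in> borel_measurable lborel" by measurable
  have "set_integrable lborel (einterval (-\<infinity>) \<infinity>) (\<lambda>x::real. inverse (1 + x\<^sup>2))"
    by (rule integrable_inverse_1_plus_square)
  then have "integrable lborel (\<lambda>u::real. 1 / (1 + u\<^sup>2))"
    by (simp add: set_integrable_def einterval_def inverse_eq_divide)
  then have int: "integrable lebesgue (\<lambda>u::real. 1 / (1 + u\<^sup>2))"
    by (simp add: integrable_completion)
  have "(LINT u|lborel. 1 / (1 + (u::real)\<^sup>2)) = pi"
    using LBINT_inverse_1_plus_square
    by (simp add: interval_lebesgue_integral_def set_lebesgue_integral_def einterval_def inverse_eq_divide)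
  then have val: "(LINT u|lebesgue. 1 / (1 + (u::real)\<^sup>2)) = pi"
    by (simp add: integral_completion)
  show "integrable lebesgue (\<lambda>u::real. 1 / (1 + (x - u)\<^sup>2))"
    using lebesgue_integrable_real_affine[OF int, of "-1" x] by simp
  show "(LINT u|lebesgue. 1 / (1 + (x - u)\<^sup>2)) = pi"
    using lebesgue_integral_real_affine[of "-1" "\<lambda>u. 1 / (1 + u\<^sup>2)" x] val by simp
qed

lemma sinc_kernel_L2:
  assumes "0 \<le> \<omega>"
  shows "(\<lambda>u. sinc_kernel \<omega> (z - of_real u)) \<in> L2 UNIV lebesgue"
    and "(LINT u|lebesgue. (norm (sinc_kernel \<omega> (z - of_real u)))\<^sup>2)
           \<le> (4 * \<omega>\<^sup>2 + 1) * (exp (2 * pi * \<omega> * \<bar>Im z\<bar>))\<^sup>2 * pi"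
proof -
  let ?C = "(4 * \<omega>\<^sup>2 + 1) * (exp (2 * pi * \<omega> * \<bar>Im z\<bar>))\<^sup>2"
  have le: "(norm (sinc_kernel \<omega> (z - of_real u)))\<^sup>2 \<le> ?C * (1 / (1 + (Re z - u)\<^sup>2))" for u
    using norm_sinc_kernel_sq_le[OF assms, of "z - of_real u"] by simp
  have int: "integrable lebesgue (\<lambda>u. ?C * (1 / (1 + (Re z - u)\<^sup>2)))"
    by (intro integrable_mult_right Cauchy_density_integrable)
  show L2: "(\<lambda>u. sinc_kernel \<omega> (z - of_real u)) \<in> L2 UNIV lebesgue"
    by (rule L2_I_bound[OF _ _ int]) (use le in \<open>auto intro!: borel_imp_lebesgue_measurable\<close>)
  have "(LINT u|lebesgue. (norm (sinc_kernel \<omega> (z - of_real u)))\<^sup>2)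
      \<le> (LINT u|lebesgue. ?C * (1 / (1 + (Re z - u)\<^sup>2)))"
    by (rule integral_mono[OF L2_integrable_norm_sq[OF L2] int]) (rule le)
  also have "\<dots> = ?C * pi"
    unfolding integral_mult_right_zero Cauchy_density_integral ..
  finally show "(LINT u|lebesgue. (norm (sinc_kernel \<omega> (z - of_real u)))\<^sup>2) \<le> ?C * pi" .
qed

section \<open>The Fourier transform tested against the sinc kernel\<close>

text \<open>
  For integrable \<open>g\<close> this is Fubini's theorem, after the kernel has been written as an integral of
  exponentials. The truncations of a square-integrable function are integrable, and
  \<^const>\<open>has_fourier_transform\<close> speaks about their transforms.
\<close>

lemma fourier_sinc_Fubini:
  fixes g :: "real \<Rightarrow> complex"
  assumes g: "integrable lebesgue g" and \<omega>: "0 \<le> \<omega>"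
  defines "ft \<equiv> (\<lambda>\<xi>. LINT t|lebesgue. g t * cis (- (2 * pi * \<xi> * t)))"
  shows "ft \<in> borel_measurable lebesgue"
    and "integrable lebesgue (\<lambda>\<xi>. indicator {-\<omega>..\<omega>} \<xi> *\<^sub>R (ft \<xi> * exp_2pi_i (of_real \<xi> * z)))"
    and "(LINT t|lebesgue. g t * sinc_kernel \<omega> (z - of_real t))
           = (LINT \<xi>:{-\<omega>..\<omega>}|lebesgue. ft \<xi> * exp_2pi_i (of_real \<xi> * z))"
proof -
  interpret pair_sigma_finite "lebesgue :: real measure" "lebesgue :: real measure"
    by (rule pair_sigma_finite_lebesgue)
  have [measurable]: "g \<in> borel_measurable lebesgue" using g by auto
  note [measurable] = of_real_fst_measurable of_real_snd_measurable
  have cis_eq: "cis (- (2 * pi * \<xi> * t)) = exp_2pi_i (- (of_real \<xi> * of_real t))" for \<xi> t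
    by (simp add: cis_conv_exp mult_ac)
  show "ft \<in> borel_measurable lebesgue"
    unfolding ft_def cis_eq
  proof (rule sigma_finite_measure.borel_measurable_lebesgue_integral[OF sigma_finite_lebesgue])
    have "(\<lambda>p. g (snd p) * exp_2pi_i (- (of_real (fst p) * of_real (snd p)))) \<in> borel_measurable (lebesgue \<Otimes>\<^sub>M lebesgue)"
      by measurable
    then show "(\<lambda>(\<xi>, t). g t * exp_2pi_i (- (of_real \<xi> * of_real t))) \<in> borel_measurable (lebesgue \<Otimes>\<^sub>M lebesgue)"
      by (simp add: case_prod_beta)
  qed
  define G where "G t \<xi> = g t * (indicator {-\<omega>..\<omega>} \<xi> *\<^sub>R exp_2pi_i (of_real \<xi> * (z - of_real t)))" for t \<xi>
  have normG: "norm (G t \<xi>) = norm (g t) * (indicator {-\<omega>..\<omega>} \<xi> * norm (exp_2pi_i (of_real \<xi> * z)))" for t \<xi>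
    unfolding G_def by (simp add: norm_mult norm_exp_2pi_i del: norm_exp_eq_Re)
  have int_G: "integrable lebesgue (G t)" for t
    using exp_2pi_i_integrable_interval[of "-\<omega>" \<omega> "z - of_real t"]
    unfolding G_def set_integrable_def by (intro integrable_mult_right)
  have [measurable]: "(\<lambda>p. indicator {-\<omega>..\<omega>} (snd p) :: real) \<in> borel_measurable (lebesgue \<Otimes>\<^sub>M lebesgue)"
    by (rule measurable_compose[OF measurable_snd]) (intro borel_measurable_indicator, simp)
  have G: "integrable (lebesgue \<Otimes>\<^sub>M lebesgue) (case_prod G)"
  proof (rule Fubini_integrable)
    have "(\<lambda>p. G (fst p) (snd p)) \<in> borel_measurable (lebesgue \<Otimes>\<^sub>M lebesgue)"
      unfolding G_def by measurable
    then show "case_prod G \<in> borel_measurable (lebesgue \<Otimes>\<^sub>M lebesgue)"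
      by (simp add: case_prod_beta)
    have "integrable lebesgue (\<lambda>t. norm (g t) * (LINT \<xi>|lebesgue. indicator {-\<omega>..\<omega>} \<xi> * norm (exp_2pi_i (of_real \<xi> * z))))"
      by (intro integrable_mult_left integrable_norm g)
    then show "integrable lebesgue (\<lambda>t. LINT \<xi>|lebesgue. norm (case_prod G (t, \<xi>)))"
      by (simp add: normG)
  qed (use int_G in simp)
  have snd: "(LINT t|lebesgue. G t \<xi>) = indicator {-\<omega>..\<omega>} \<xi> *\<^sub>R (ft \<xi> * exp_2pi_i (of_real \<xi> * z))" for \<xi>
  proof -
    have "G t \<xi> = (indicator {-\<omega>..\<omega>} \<xi> *\<^sub>R exp_2pi_i (of_real \<xi> * z)) * (g t * exp_2pi_i (- (of_real \<xi> * of_real t)))" for t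
      unfolding G_def by (simp add: right_diff_distrib exp_diff exp_minus divide_inverse)
    then have "(LINT t|lebesgue. G t \<xi>) = (indicator {-\<omega>..\<omega>} \<xi> *\<^sub>R exp_2pi_i (of_real \<xi> * z)) * ft \<xi>"
      unfolding ft_def cis_eq by simp
    then show ?thesis by simp
  qed
  show "integrable lebesgue (\<lambda>\<xi>. indicator {-\<omega>..\<omega>} \<xi> *\<^sub>R (ft \<xi> * exp_2pi_i (of_real \<xi> * z)))"
    using integrable_snd[OF G] by (simp add: snd)
  have "(LINT t|lebesgue. g t * sinc_kernel \<omega> (z - of_real t)) = (LINT t|lebesgue. LINT \<xi>|lebesgue. G t \<xi>)"
    unfolding sinc_kernel_eq_integral[OF \<omega>] set_lebesgue_integral_def G_def integral_mult_right_zero ..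
  also have "\<dots> = (LINT \<xi>|lebesgue. LINT t|lebesgue. G t \<xi>)"
    using Fubini_integral[OF G] by simp
  finally show "(LINT t|lebesgue. g t * sinc_kernel \<omega> (z - of_real t))
           = (LINT \<xi>:{-\<omega>..\<omega>}|lebesgue. ft \<xi> * exp_2pi_i (of_real \<xi> * z))"
    unfolding snd set_lebesgue_integral_def .
qed

lemma interval_exp_L2:
  "(\<lambda>\<xi>. indicator {a..b} \<xi> *\<^sub>R exp_2pi_i (of_real \<xi> * z)) \<in> L2 UNIV lebesgue"
proof -
  have "set_integrable lebesgue {a..b} (\<lambda>\<xi>. exp_2pi_i (of_real \<xi> * (2 * \<i> * of_real (Im z))))"
    by (rule exp_2pi_i_integrable_interval)
  then have "set_integrable lebesgue {a..b} (\<lambda>\<xi>. norm (exp_2pi_i (of_real \<xi> * (2 * \<i> * of_real (Im z)))))"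
    by (rule set_integrable_norm)
  then have int: "integrable lebesgue (\<lambda>\<xi>. indicator {a..b} \<xi> *\<^sub>R norm (exp_2pi_i (of_real \<xi> * (2 * \<i> * of_real (Im z)))))"
    by (simp only: set_integrable_def)
  show ?thesis
  proof (rule L2_I_bound[OF _ _ int])
    show "(\<lambda>\<xi>. indicator {a..b} \<xi> *\<^sub>R exp_2pi_i (of_real \<xi> * z)) \<in> borel_measurable lebesgue"
      by (rule borel_imp_lebesgue_measurable) measurable
    have "(norm (exp_2pi_i (of_real \<xi> * z)))\<^sup>2 = norm (exp_2pi_i (of_real \<xi> * (2 * \<i> * of_real (Im z))))" for \<xi>
      unfolding norm_exp_2pi_i by (simp add: exp_double[symmetric] mult_ac)
    then show "AE \<xi> in lebesgue. (norm (indicator {a..b} \<xi> *\<^sub>R exp_2pi_i (of_real \<xi> * z)))\<^sup>2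
       \<le> indicator {a..b} \<xi> *\<^sub>R norm (exp_2pi_i (of_real \<xi> * (2 * \<i> * of_real (Im z))))"
      by (intro AE_I2) (simp add: indicator_def)
  qed simp
qed

lemma L2_interval_integrable:
  assumes "h \<in> L2 UNIV lebesgue"
  shows "set_integrable lebesgue {a..b} (\<lambda>\<xi>. h \<xi> * exp_2pi_i (of_real \<xi> * z))"
  using L2_mult_integrable[OF assms interval_exp_L2[of a b z]]
  by (simp add: set_integrable_def)

lemma L2_imp_set_integrable:
  assumes "h \<in> L2 UNIV lebesgue"
  shows "set_integrable lebesgue {a..b} h"
  using L2_interval_integrable[OF assms, of a b 0] by simp

text \<open>
  Both sides are limits along the truncations of \<open>f\<close> to \<open>[-n, n]\<close>, for which they agree by Fubini:
  the left one by dominated convergence, the right one because convergence in \<open>L\<^sup>2\<close> implies convergence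
  of the integrals against the exponential, which is square-integrable on \<open>[-\<omega>, \<omega>]\<close>.
\<close>

lemma fourier_transform_sinc_kernel:
  assumes f: "f \<in> L2 UNIV lebesgue" and ft: "has_fourier_transform f h" and \<omega>: "0 \<le> \<omega>"
  shows "(LINT t|lebesgue. f t * sinc_kernel \<omega> (z - of_real t))
           = (LINT \<xi>:{-\<omega>..\<omega>}|lebesgue. h \<xi> * exp_2pi_i (of_real \<xi> * z))"
proof (rule LIMSEQ_unique)
  have h: "h \<in> L2 UNIV lebesgue"
    and lim: "((\<lambda>R. \<integral>\<^sup>+ \<xi>. ennreal ((norm ((LINT t:{-R..R}|lebesgue. f t * cis (- (2 * pi * \<xi> * t))) - h \<xi>))\<^sup>2) \<partial>lebesgue) \<longlongrightarrow> 0) at_top"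
    using ft by (auto simp: has_fourier_transform_def L2_tendsto_def)
  have [measurable]: "f \<in> borel_measurable lebesgue" "h \<in> borel_measurable lebesgue"
    using f h by (auto simp: L2_def)
  define g where "g n t = indicator {- real n..real n} t *\<^sub>R f t" for n t
  define ftn where "ftn n \<xi> = (LINT t|lebesgue. g n t * cis (- (2 * pi * \<xi> * t)))" for n \<xi>
  have g: "integrable lebesgue (g n)" for n
    using L2_imp_set_integrable[OF f] unfolding g_def set_integrable_def .
  note Fub = fourier_sinc_Fubini[OF g \<omega>, folded ftn_def]
  have [measurable]: "ftn n \<in> borel_measurable lebesgue" for n
    using Fub(1)[of n] unfolding ftn_def .
  let ?S = "\<lambda>t. sinc_kernel \<omega> (z - of_real t)"
  have S_L2: "?S \<in> L2 UNIV lebesgue" by (rule sinc_kernel_L2[OF \<omega>])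
  have fS: "integrable lebesgue (\<lambda>t. f t * ?S t)" by (rule L2_mult_integrable[OF f S_L2])
  show "(\<lambda>n. LINT t|lebesgue. g n t * ?S t) \<longlonglongrightarrow> (LINT t|lebesgue. f t * ?S t)"
  proof (rule integral_dominated_convergence[OF _ _ integrable_norm[OF fS]])
    have [measurable]: "?S \<in> borel_measurable lebesgue" using S_L2 by (simp add: L2_def)
    show "(\<lambda>t. f t * ?S t) \<in> borel_measurable lebesgue" by measurable
    show "(\<lambda>t. g n t * ?S t) \<in> borel_measurable lebesgue" for n
      using g[of n] by (intro borel_measurable_times) auto
    show "AE t in lebesgue. (\<lambda>n. g n t * ?S t) \<longlonglongrightarrow> f t * ?S t"
    proof (intro AE_I2 tendsto_eventually)
      fix t :: real
      obtain N :: nat where "\<bar>t\<bar> \<le> real N" using real_arch_simple by blast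
      then have "g n t = f t" if "n \<ge> N" for n using that by (auto simp: g_def indicator_def)
      then show "\<forall>\<^sub>F n in sequentially. g n t * ?S t = f t * ?S t"
        unfolding eventually_sequentially by metis
    qed
    show "AE t in lebesgue. norm (g n t * ?S t) \<le> norm (f t * ?S t)" for n
      by (intro AE_I2) (simp add: g_def indicator_def)
  qed
  define E where "E \<xi> = indicator {-\<omega>..\<omega>} \<xi> *\<^sub>R exp_2pi_i (of_real \<xi> * z)" for \<xi>
  have E: "E \<in> L2 UNIV lebesgue" unfolding E_def by (rule interval_exp_L2)
  then have [measurable]: "E \<in> borel_measurable lebesgue" by (simp add: L2_def)
  have ftnE: "integrable lebesgue (\<lambda>\<xi>. ftn n \<xi> * E \<xi>)" for n
    using Fub(2)[of n z] by (simp add: E_def ftn_def)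
  have hE: "integrable lebesgue (\<lambda>\<xi>. h \<xi> * E \<xi>)" by (rule L2_mult_integrable[OF h E])
  let ?c = "\<integral>\<^sup>+ \<xi>. (ennreal (norm (E \<xi>)))\<^sup>2 \<partial>lebesgue"
  have c: "?c < top"
    using E by (auto simp: L2_def integrable_iff_bounded ennreal_power)
  let ?d = "\<lambda>n. \<integral>\<^sup>+ \<xi>. (ennreal (norm (ftn n \<xi> - h \<xi>)))\<^sup>2 \<partial>lebesgue"
  have d: "?d \<longlonglongrightarrow> 0"
    using filterlim_compose[OF lim filterlim_real_sequentially]
    by (simp add: ennreal_power ftn_def g_def set_lebesgue_integral_def)
  have bound: "ennreal ((norm ((LINT \<xi>|lebesgue. ftn n \<xi> * E \<xi>) - (LINT \<xi>|lebesgue. h \<xi> * E \<xi>)))\<^sup>2) \<le> ?c * ?d n" for n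
  proof -
    have int: "integrable lebesgue (\<lambda>\<xi>. (ftn n \<xi> - h \<xi>) * E \<xi>)"
      using Bochner_Integration.integrable_diff[OF ftnE hE] by (simp add: left_diff_distrib)
    have "(LINT \<xi>|lebesgue. ftn n \<xi> * E \<xi>) - (LINT \<xi>|lebesgue. h \<xi> * E \<xi>) = (LINT \<xi>|lebesgue. (ftn n \<xi> - h \<xi>) * E \<xi>)"
      using Bochner_Integration.integral_diff[OF ftnE hE] by (simp add: left_diff_distrib)
    then have "ennreal (norm ((LINT \<xi>|lebesgue. ftn n \<xi> * E \<xi>) - (LINT \<xi>|lebesgue. h \<xi> * E \<xi>)))
        \<le> (\<integral>\<^sup>+ \<xi>. norm ((ftn n \<xi> - h \<xi>) * E \<xi>) \<partial>lebesgue)"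
      using integral_norm_bound_ennreal[OF int] by simp
    also have "\<dots> = (\<integral>\<^sup>+ \<xi>. ennreal (norm (E \<xi>)) * ennreal (norm (ftn n \<xi> - h \<xi>)) \<partial>lebesgue)"
      by (simp add: norm_mult ennreal_mult mult.commute)
    finally have "(ennreal (norm ((LINT \<xi>|lebesgue. ftn n \<xi> * E \<xi>) - (LINT \<xi>|lebesgue. h \<xi> * E \<xi>))))\<^sup>2
        \<le> (\<integral>\<^sup>+ \<xi>. ennreal (norm (E \<xi>)) * ennreal (norm (ftn n \<xi> - h \<xi>)) \<partial>lebesgue)\<^sup>2"
      by (rule power_mono) simp
    also have "\<dots> \<le> ?c * ?d n"
      by (rule Cauchy_Schwarz_nn_integral) measurable
    finally show ?thesis by (simp add: ennreal_power)
  qed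
  have "(\<lambda>n. ?c * ?d n) \<longlonglongrightarrow> ?c * 0" by (rule ennreal_tendsto_cmult[OF c d])
  then have "(\<lambda>n. ?c * ?d n) \<longlonglongrightarrow> 0" by simp
  then have "(\<lambda>n. ennreal ((norm ((LINT \<xi>|lebesgue. ftn n \<xi> * E \<xi>) - (LINT \<xi>|lebesgue. h \<xi> * E \<xi>)))\<^sup>2)) \<longlonglongrightarrow> 0"
    by (rule tendsto_sandwich[rotated 2, OF tendsto_const]) (use bound in auto)
  then have "(\<lambda>n. (norm ((LINT \<xi>|lebesgue. ftn n \<xi> * E \<xi>) - (LINT \<xi>|lebesgue. h \<xi> * E \<xi>)))\<^sup>2) \<longlonglongrightarrow> 0"
    by (subst (asm) ennreal_tendsto_0_iff) auto
  then have "(\<lambda>n. LINT \<xi>|lebesgue. ftn n \<xi> * E \<xi>) \<longlonglongrightarrow> (LINT \<xi>|lebesgue. h \<xi> * E \<xi>)"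
    by (simp add: tendsto_norm_zero_iff LIM_zero_iff)
  moreover have "(LINT \<xi>|lebesgue. ftn n \<xi> * E \<xi>) = (LINT t|lebesgue. g n t * ?S t)" for n
    using Fub(3)[of n z] by (simp add: E_def ftn_def set_lebesgue_integral_def)
  ultimately show "(\<lambda>n. LINT t|lebesgue. g n t * ?S t) \<longlonglongrightarrow> (LINT \<xi>:{-\<omega>..\<omega>}|lebesgue. h \<xi> * exp_2pi_i (of_real \<xi> * z))"
    by (simp add: E_def set_lebesgue_integral_def)
qed

text \<open>
  The complement of the support is a union of open sets on each of which \<open>h\<close> is almost everywhere
  zero; by Lindelof countably many of them suffice.
\<close>

lemma AE_zero_outside_ess_support:
  "AE t in lebesgue. t \<notin> ess_support h \<longrightarrow> h t = 0"
proof -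
  let ?\<F> = "{U. open U \<and> (AE t in lebesgue. t \<in> U \<longrightarrow> h t = 0)}"
  obtain \<G> where \<G>: "\<G> \<subseteq> ?\<F>" "countable \<G>" "\<Union>\<G> = \<Union>?\<F>"
    using Lindelof[of ?\<F>] by auto
  have "AE t in lebesgue. \<forall>U\<in>\<G>. t \<in> U \<longrightarrow> h t = 0"
    using \<G> by (subst AE_ball_countable) auto
  then show ?thesis
    by eventually_elim (use \<G>(3) in \<open>auto simp: ess_support_def\<close>)
qed

definition band_limited_extension :: "real \<Rightarrow> (real \<Rightarrow> complex) \<Rightarrow> complex \<Rightarrow> complex" where
  "band_limited_extension \<rho> h z = (LINT \<xi>:{-\<rho>..\<rho>}|lebesgue. h \<xi> * exp_2pi_i (of_real \<xi> * z))"

text \<open>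
  The right-hand side is independent of \<open>\<omega>\<close>. This is used twice: with \<open>\<omega>\<close> tending to
  infinity, to identify \<open>f\<close>, and with \<open>\<omega>\<close> adapted to a dilation, so that all wavelets up to a given
  scale are reproduced by the same kernel.
\<close>

lemma sinc_kernel_reproduces:
  assumes f: "f \<in> L2 UNIV lebesgue" and ft: "has_fourier_transform f h"
    and supp: "ess_support h \<subseteq> {-\<rho>..\<rho>}" and \<omega>: "0 \<le> \<rho>" "\<rho> \<le> \<omega>"
  shows "(LINT t|lebesgue. f t * sinc_kernel \<omega> (z - of_real t)) = band_limited_extension \<rho> h z"
proof -
  have h: "h \<in> L2 UNIV lebesgue" using ft by (simp add: has_fourier_transform_def)
  have meas: "set_borel_measurable lebesgue {a..b} (\<lambda>\<xi>. h \<xi> * exp_2pi_i (of_real \<xi> * z))" for a b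
    using L2_interval_integrable[OF h, of a b z] by (auto simp: set_integrable_def set_borel_measurable_def)
  have "(LINT \<xi>:{-\<omega>..\<omega>}|lebesgue. h \<xi> * exp_2pi_i (of_real \<xi> * z)) = band_limited_extension \<rho> h z"
    unfolding band_limited_extension_def set_lebesgue_integral_def
  proof (rule integral_cong_AE)
    show "AE \<xi> in lebesgue. indicator {-\<omega>..\<omega>} \<xi> *\<^sub>R (h \<xi> * exp_2pi_i (of_real \<xi> * z))
        = indicator {-\<rho>..\<rho>} \<xi> *\<^sub>R (h \<xi> * exp_2pi_i (of_real \<xi> * z))"
      using AE_zero_outside_ess_support[of h]
      by eventually_elim (use supp \<omega> in \<open>auto simp: indicator_def\<close>)
  qed (use meas in \<open>auto simp: set_borel_measurable_def\<close>)
  then show ?thesis using fourier_transform_sinc_kernel[OF f ft, of \<omega> z] \<omega> by simp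
qed

text \<open>
  Expanding the exponential and integrating term by term gives a power series in \<open>z\<close>; the
  exchange is dominated since \<open>\<xi>\<close> ranges over a bounded interval.
\<close>

lemma band_limited_extension_holomorphic:
  assumes h: "h \<in> L2 UNIV lebesgue"
  shows "band_limited_extension \<rho> h holomorphic_on UNIV"
proof -
  define H where "H \<xi> = indicator {-\<rho>..\<rho>} \<xi> *\<^sub>R h \<xi>" for \<xi>
  have H: "integrable lebesgue H"
    using L2_imp_set_integrable[OF h] unfolding H_def set_integrable_def .
  then have [measurable]: "H \<in> borel_measurable lebesgue" by auto
  note [measurable] = of_real_measurable_lebesgue
  define T :: "complex \<Rightarrow> nat \<Rightarrow> real \<Rightarrow> complex" where "T z n \<xi> = H \<xi> * ((2 * of_real pi * \<i> * (of_real \<xi> * z)) ^ n / fact n)" for z n \<xi>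
  define a where "a n = (LINT \<xi>|lebesgue. T 1 n \<xi>)" for n
  have T_meas [measurable]: "T z n \<in> borel_measurable lebesgue" for z n
    unfolding T_def by measurable
  define w :: "complex \<Rightarrow> real \<Rightarrow> real" where "w z \<xi> = norm (H \<xi>) * exp (2 * pi * \<bar>\<rho>\<bar> * norm z)" for z \<xi>
  have w_int: "integrable lebesgue (w z)" for z
    unfolding w_def by (intro integrable_mult_left integrable_norm H)
  have exp_sums: "(\<lambda>n. norm ((2 * of_real pi * \<i> * (of_real \<xi> * z)) ^ n / fact n)) sums exp (2 * pi * \<bar>\<xi>\<bar> * norm z)" for \<xi> z
    using exp_converges[of "2 * pi * \<bar>\<xi>\<bar> * norm z"]
    by (simp add: norm_mult norm_divide norm_power divide_inverse norm_inverse mult_ac abs_mult)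
  have partial: "norm (H \<xi>) * (\<Sum>i\<in>I. norm ((2 * of_real pi * \<i> * (of_real \<xi> * z)) ^ i / fact i)) \<le> w z \<xi>"
    if "finite I" for I \<xi> z
  proof (cases "\<xi> \<in> {-\<rho>..\<rho>}")
    case True
    have "(\<Sum>i\<in>I. norm ((2 * of_real pi * \<i> * (of_real \<xi> * z)) ^ i / fact i)) \<le> exp (2 * pi * \<bar>\<xi>\<bar> * norm z)"
      using sum_le_suminf[OF sums_summable[OF exp_sums[of \<xi> z]] that] sums_unique[OF exp_sums[of \<xi> z]] by simp
    also have "\<dots> \<le> exp (2 * pi * \<bar>\<rho>\<bar> * norm z)"
      using True by (auto intro!: mult_right_mono)
    finally show ?thesis unfolding w_def by (intro mult_left_mono) auto
  qed (simp add: H_def w_def)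
  have T_int: "integrable lebesgue (T z n)" for z n
  proof (rule Bochner_Integration.integrable_bound[OF w_int[of z]])
    show "AE \<xi> in lebesgue. norm (T z n \<xi>) \<le> norm (w z \<xi>)"
      using partial[of "{n}" _ z]
      by (intro AE_I2) (simp add: T_def w_def norm_mult del: times_divide_eq_right)
  qed measurable
  have power_series: "(\<lambda>n. a n * z ^ n) sums band_limited_extension \<rho> h z" for z
  proof -
    have term_eq: "a n * z ^ n = (LINT \<xi>|lebesgue. T z n \<xi>)" for n
    proof -
      have "T z n \<xi> = T 1 n \<xi> * z ^ n" for \<xi> by (simp add: T_def power_mult_distrib)
      then show ?thesis by (simp add: a_def)
    qed
    have sum_eq: "(\<Sum>i<n. a i * z ^ i) = (LINT \<xi>|lebesgue. (\<Sum>i<n. T z i \<xi>))" for n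
      unfolding term_eq by (rule Bochner_Integration.integral_sum[symmetric]) (rule T_int)
    have "(\<lambda>n. LINT \<xi>|lebesgue. (\<Sum>i<n. T z i \<xi>)) \<longlonglongrightarrow> (LINT \<xi>|lebesgue. H \<xi> * exp_2pi_i (of_real \<xi> * z))"
    proof (rule integral_dominated_convergence[OF _ _ w_int[of z]])
      show "(\<lambda>\<xi>. H \<xi> * exp_2pi_i (of_real \<xi> * z)) \<in> borel_measurable lebesgue" by measurable
      show "(\<lambda>\<xi>. \<Sum>i<n. T z i \<xi>) \<in> borel_measurable lebesgue" for n by measurable
      have "(\<lambda>n. (2 * of_real pi * \<i> * (of_real \<xi> * z)) ^ n / fact n) sums exp_2pi_i (of_real \<xi> * z)" for \<xi>
        using exp_converges[of "2 * of_real pi * \<i> * (of_real \<xi> * z)"]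
        by (simp add: scaleR_conv_of_real divide_inverse mult.commute)
      then have "(\<lambda>n. T z n \<xi>) sums (H \<xi> * exp_2pi_i (of_real \<xi> * z))" for \<xi>
        unfolding T_def by (rule sums_mult)
      then show "AE \<xi> in lebesgue. (\<lambda>n. \<Sum>i<n. T z i \<xi>) \<longlonglongrightarrow> H \<xi> * exp_2pi_i (of_real \<xi> * z)"
        by (simp add: sums_def)
      show "AE \<xi> in lebesgue. norm (\<Sum>i<n. T z i \<xi>) \<le> w z \<xi>" for n
      proof (rule AE_I2)
        fix \<xi> :: real
        have "norm (\<Sum>i<n. T z i \<xi>) \<le> (\<Sum>i<n. norm (T z i \<xi>))" by (rule norm_sum)
        also have "\<dots> = norm (H \<xi>) * (\<Sum>i<n. norm ((2 * of_real pi * \<i> * (of_real \<xi> * z)) ^ i / fact i))"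
          unfolding sum_distrib_left T_def by (intro sum.cong refl norm_mult)
        also have "\<dots> \<le> w z \<xi>" by (rule partial) simp
        finally show "norm (\<Sum>i<n. T z i \<xi>) \<le> w z \<xi>" .
      qed
    qed
    then show ?thesis
      unfolding sums_def sum_eq band_limited_extension_def set_lebesgue_integral_def H_def by simp
  qed
  have "band_limited_extension \<rho> h holomorphic_on ball 0 r" for r
    by (rule power_series_holomorphic[where a = a]) (use power_series in simp)
  then show ?thesis
    by (metis UNIV_I centre_in_ball holomorphic_on_open open_UNIV open_ball dist_0_norm mem_ball
        gt_ex)
qed

section \<open>Fourier inversion for band-limited functions\<close>

text \<open>
  On a bounded interval \<open>[-n, n]\<close>, the sets over which the integral vanishes form a Dynkin system that
  contains the intervals, hence all Borel sets, and then all Lebesgue sets.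
\<close>

lemma AE_zero_if_interval_integrals_zero:
  fixes f :: "real \<Rightarrow> complex"
  assumes int: "\<And>a b. set_integrable lebesgue {a..b} f"
    and zero: "\<And>a b. a \<le> b \<Longrightarrow> (LINT t:{a..b}|lebesgue. f t) = 0"
  shows "AE t in lebesgue. f t = 0"
proof -
  interpret sigma_finite_measure "lebesgue :: real measure" by (rule sigma_finite_lebesgue)
  have "AE t in lebesgue. indicator {-real n..real n} t *\<^sub>R f t = 0" for n
  proof (rule density_zero)
    define F where "F t = indicator {-real n..real n} t *\<^sub>R f t" for t
    show F: "integrable lebesgue (\<lambda>t. indicator {-real n..real n} t *\<^sub>R f t)"
      using int unfolding set_integrable_def .
    have setF: "set_integrable lebesgue S F" if "S \<in> sets lebesgue" for S
      using integrable_mult_indicator[OF that F] by (simp add: F_def set_integrable_def)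
    have interval: "(LINT t:{a..b}|lebesgue. F t) = 0" for a b
    proof -
      have "(LINT t:{a..b}|lebesgue. F t) = (LINT t:{max a (-real n)..min b (real n)}|lebesgue. f t)"
        unfolding set_lebesgue_integral_def F_def
        by (intro Bochner_Integration.integral_cong) (auto simp: indicator_def)
      also have "\<dots> = 0"
        using zero[of "max a (-real n)" "min b (real n)"]
        by (cases "max a (-real n) \<le> min b (real n)") (simp_all add: set_lebesgue_integral_def)
      finally show ?thesis .
    qed
    have whole: "(LINT t|lebesgue. F t) = 0"
    proof -
      have "(LINT t|lebesgue. F t) = (LINT t:{-real n..real n}|lebesgue. F t)"
        unfolding set_lebesgue_integral_def F_def
        by (intro Bochner_Integration.integral_cong) (auto simp: indicator_def)
      then show ?thesis using interval by simp
    qed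
    have borel: "(LINT t:S|lebesgue. F t) = 0" if "S \<in> sets borel" for S
    proof -
      let ?G = "range (\<lambda>(a, b). {a..b} :: real set)"
      have Int: "Int_stable ?G"
      proof (rule Int_stableI)
        fix X Y assume "X \<in> ?G" "Y \<in> ?G"
        then obtain a b c d where "X = {a..b}" "Y = {c..d}" by auto
        then have "X \<inter> Y = (\<lambda>(a, b). {a..b}) (max a c, min b d)" by auto
        then show "X \<inter> Y \<in> ?G" by (rule range_eqI)
      qed
      have sets: "sigma_sets UNIV ?G = sets (borel :: real measure)"
        by (subst borel_eq_atLeastAtMost) auto
      have "S \<in> sigma_sets UNIV ?G" using that sets by simp
      have "?G \<subseteq> Pow UNIV" by simp
      from Int this \<open>S \<in> sigma_sets UNIV ?G\<close> show ?thesis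
      proof (induction rule: sigma_sets_induct_disjoint)
        case (compl S)
        then have S: "S \<in> sets lebesgue" unfolding sets by simp
        have "(LINT t:S|lebesgue. F t) + (LINT t:(UNIV - S)|lebesgue. F t) = (LINT t:(S \<union> (UNIV - S))|lebesgue. F t)"
          using S by (intro set_integral_Un[symmetric] setF) auto
        also have "S \<union> (UNIV - S) = UNIV" by auto
        finally show ?case using compl whole by (simp add: set_lebesgue_integral_def)
      next
        case (union \<S>)
        then have S: "\<S> i \<in> sets lebesgue" for i unfolding sets by (auto simp: image_subset_iff)
        have "(LINT t:(\<Union>i. \<S> i)|lebesgue. F t) = (\<Sum>i. (LINT t:\<S> i|lebesgue. F t))"
          using S union(1) by (intro lebesgue_integral_countable_add setF) (auto simp: disjoint_family_on_def)
        then show ?case using union by simp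
      qed (use interval in \<open>auto simp: set_lebesgue_integral_def\<close>)
    qed
    fix S :: "real set" assume "S \<in> sets lebesgue"
    then obtain S' N N' where S: "S = S' \<union> N" "N \<subseteq> N'" "N' \<in> null_sets lborel" "S' \<in> sets lborel"
      by (rule sets_completionE)
    have "(LINT t:S|lebesgue. F t) = (LINT t:S'|lebesgue. F t)"
    proof (rule set_integral_null_delta)
      have "(S - S') \<union> (S' - S) \<subseteq> N'" using S by auto
      then show "(S - S') \<union> (S' - S) \<in> null_sets lebesgue"
        using S by (metis null_sets_completion_subset null_sets_completionI)
    qed (use F S \<open>S \<in> sets lebesgue\<close> in \<open>auto simp: F_def\<close>)
    then show "(LINT t:S|lebesgue. indicator {-real n..real n} t *\<^sub>R f t) = 0"
      using borel[of S'] S by (simp add: F_def)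
  qed
  then have "AE t in lebesgue. \<forall>n. indicator {-real n..real n} t *\<^sub>R f t = 0"
    unfolding AE_all_countable by blast
  then show ?thesis
  proof eventually_elim
    case (elim t)
    obtain n :: nat where "\<bar>t\<bar> \<le> real n" using real_arch_simple by blast
    with elim[rule_format, of n] show ?case by (auto simp: indicator_def abs_le_iff)
  qed
qed

text \<open>
  A primitive of the kernel on the real line is the sine integral, so averages of the kernel over
  \<open>[a, b]\<close> converge boundedly, as \<open>\<omega>\<close> grows, to the indicator function of \<open>[a, b]\<close>.
\<close>

lemma integral_sinc_kernel:
  assumes "a \<le> b" "0 < \<omega>"
  shows "(LINT s:{a..b}|lebesgue. sinc_kernel \<omega> (of_real s - of_real t))
           = of_real ((Si (2 * pi * \<omega> * (b - t)) - Si (2 * pi * \<omega> * (a - t))) / pi)"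
proof -
  let ?k = "\<lambda>s. 2 * \<omega> * sinc (2 * pi * \<omega> * (s - t))"
  have kernel: "sinc_kernel \<omega> (of_real s - of_real t) = of_real (?k s)" for s
    unfolding sinc_kernel_of_real[symmetric] of_real_diff ..
  have isCont: "isCont ?k s" for s
    by (intro continuous_intros isCont_o2[OF _ isCont_sinc])
  then have cont: "continuous_on {a..b} ?k"
    by (intro continuous_at_imp_continuous_on ballI)
  have meas: "(\<lambda>s. indicator {a..b} s *\<^sub>R ?k s) \<in> borel_measurable lborel"
    using borel_integrable_compact[OF _ cont] by auto
  have deriv: "((\<lambda>s. Si (2 * pi * \<omega> * (s - t)) / pi) has_real_derivative ?k s) (at s)" for s
  proof -
    have "((\<lambda>s. 2 * pi * \<omega> * (s - t)) has_real_derivative 2 * pi * \<omega>) (at s)"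
      by (auto intro!: derivative_eq_intros)
    then have "((\<lambda>s. Si (2 * pi * \<omega> * (s - t)) / pi) has_real_derivative sinc (2 * pi * \<omega> * (s - t)) * (2 * pi * \<omega>) / pi) (at s)"
      by (intro DERIV_cdivide DERIV_chain2[OF DERIV_Si])
    moreover have "x * (2 * pi * \<omega>) / pi = 2 * \<omega> * x" for x by simp
    ultimately show ?thesis by metis
  qed
  have "(LINT s:{a..b}|lebesgue. sinc_kernel \<omega> (of_real s - of_real t)) = of_real (LINT s:{a..b}|lebesgue. ?k s)"
    unfolding kernel by (rule set_integral_complex_of_real)
  also have "(LINT s:{a..b}|lebesgue. ?k s) = Si (2 * pi * \<omega> * (b - t)) / pi - Si (2 * pi * \<omega> * (a - t)) / pi"
    unfolding set_lebesgue_integral_def integral_completion[OF meas]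
    by (rule integral_FTC_Icc[OF assms(1) has_vector_derivative_at_within cont])
      (rule deriv[unfolded has_real_derivative_iff_has_vector_derivative])
  finally show ?thesis by (simp add: diff_divide_distrib)
qed

lemma
  shows Si_scale_tendsto_pos: "c > 0 \<Longrightarrow> (\<lambda>n. Si (2 * pi * real n * c)) \<longlonglongrightarrow> pi / 2"
    and Si_scale_tendsto_neg: "c < 0 \<Longrightarrow> (\<lambda>n. Si (2 * pi * real n * c)) \<longlonglongrightarrow> - (pi / 2)"
proof -
  have pos: "(\<lambda>n. Si (2 * pi * real n * c)) \<longlonglongrightarrow> pi / 2" if "c > 0" for c
  proof -
    have "filterlim (\<lambda>n. 2 * pi * real n * c) at_top sequentially"
      using that by real_asymp
    then show ?thesis by (rule filterlim_compose[OF Si_at_top])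
  qed
  show "c > 0 \<Longrightarrow> (\<lambda>n. Si (2 * pi * real n * c)) \<longlonglongrightarrow> pi / 2" by (rule pos)
  assume "c < 0"
  then have "Si (2 * pi * real n * c) = - Si (2 * pi * real n * (- c))" for n
    using Si_neg[of "2 * pi * real n * (- c)"] by (simp add: mult_nonneg_nonpos)
  then show "(\<lambda>n. Si (2 * pi * real n * c)) \<longlonglongrightarrow> - (pi / 2)"
    using tendsto_minus[OF pos[of "- c"]] \<open>c < 0\<close> by simp
qed

text \<open>
  A square-integrable majorant, uniform in \<open>\<omega>\<close>, for the averages of the kernel over
  \<open>[a, b]\<close>: the sine integral is bounded, and away from \<open>[a, b]\<close> the kernel itself is at most
  \<open>1 / \<bar>s - t\<bar>\<close>.
\<close>

lemma integrated_sinc_kernel_bound: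
  assumes "a \<le> b"
  obtains C where "\<And>\<omega> t. 0 < \<omega> \<Longrightarrow>
    (norm (LINT s:{a..b}|lebesgue. sinc_kernel \<omega> (of_real s - of_real t)))\<^sup>2 \<le> C * (1 / (1 + (0 - t)\<^sup>2))"
proof -
  obtain M where M: "\<And>x. \<bar>Si x\<bar> \<le> M" using bounded_Si by blast
  \<comment> \<open>If \<open>\<bar>t\<bar> > D\<close>, then every \<open>s\<close> in \<open>[a, b]\<close> has distance at least \<open>\<bar>t\<bar> / 2\<close> from \<open>t\<close>.\<close>
  define D where "D = 1 + 2 * max \<bar>a\<bar> \<bar>b\<bar>"
  define C where "C = (2 * M)\<^sup>2 * (1 + D\<^sup>2) + (2 * (b - a))\<^sup>2 * 2"
  have "(norm (LINT s:{a..b}|lebesgue. sinc_kernel \<omega> (of_real s - of_real t)))\<^sup>2 \<le> C * (1 / (1 + (0 - t)\<^sup>2))"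
    if \<omega>: "0 < \<omega>" for \<omega> t
  proof -
    let ?G = "LINT s:{a..b}|lebesgue. sinc_kernel \<omega> (of_real s - of_real t)"
    have pos: "0 < 1 + t\<^sup>2" by (simp add: add_pos_nonneg)
    have "(norm ?G)\<^sup>2 * (1 + t\<^sup>2) \<le> C"
    proof (cases "\<bar>t\<bar> \<le> D")
      case True
      have "norm ?G = \<bar>Si (2 * pi * \<omega> * (b - t)) - Si (2 * pi * \<omega> * (a - t))\<bar> / pi"
        unfolding integral_sinc_kernel[OF assms \<omega>] norm_of_real by (simp add: abs_divide)
      also have "\<dots> \<le> (2 * M) / 1"
        using M[of "2 * pi * \<omega> * (b - t)"] M[of "2 * pi * \<omega> * (a - t)"] pi_gt3
        by (intro frac_le) auto
      finally have "(norm ?G)\<^sup>2 \<le> (2 * M)\<^sup>2" by (intro power_mono) auto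
      moreover have "1 + t\<^sup>2 \<le> 1 + D\<^sup>2"
        using True by (simp add: D_def abs_le_square_iff[symmetric])
      ultimately have "(norm ?G)\<^sup>2 * (1 + t\<^sup>2) \<le> (2 * M)\<^sup>2 * (1 + D\<^sup>2)"
        using pos by (intro mult_mono) auto
      then show ?thesis by (simp add: C_def add_increasing2)
    next
      case False
      then have t: "1 \<le> \<bar>t\<bar>" by (simp add: D_def)
      have "norm ?G \<le> (LINT s:{a..b}|lebesgue. 2 / \<bar>t\<bar>)"
        unfolding set_lebesgue_integral_def
      proof (rule Bochner_Integration.integral_norm_bound_integral)
        have meas: "(\<lambda>s. indicator {a..b} s *\<^sub>R sinc_kernel \<omega> (of_real s - of_real t)) \<in> borel_measurable borel"
          by measurable
        show int: "integrable lebesgue (\<lambda>s. indicator {a..b} s *\<^sub>R (2 / \<bar>t\<bar>))"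
          by (intro integrable_scaleR_left integrable_real_indicator) (auto simp: emeasure_lborel_Icc_eq)
        have "norm (sinc_kernel \<omega> (of_real s - of_real t)) \<le> 2 / \<bar>t\<bar>" if s: "s \<in> {a..b}" for s
        proof -
          have half: "\<bar>t\<bar> / 2 \<le> \<bar>s - t\<bar>" 
          proof -
            have "2 * \<bar>a\<bar> \<le> \<bar>t\<bar>" "2 * \<bar>b\<bar> \<le> \<bar>t\<bar>"
              using False max.cobounded1[of "\<bar>a\<bar>" "\<bar>b\<bar>"] max.cobounded2[of "\<bar>b\<bar>" "\<bar>a\<bar>"]
              unfolding D_def by linarith+
            then have "2 * \<bar>s\<bar> \<le> \<bar>t\<bar>" using s by (simp, arith)
            moreover have "\<bar>t\<bar> \<le> \<bar>s - t\<bar> + \<bar>s\<bar>" by arith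
            ultimately show ?thesis by linarith
          qed
          then have ne: "s \<noteq> t" using t by auto
          have "norm (sinc_kernel \<omega> (of_real s - of_real t)) = \<bar>sin (2 * pi * \<omega> * (s - t))\<bar> / (pi * \<bar>s - t\<bar>)"
            using ne \<omega> unfolding of_real_diff[symmetric] sinc_kernel_of_real norm_of_real
            by (simp add: abs_mult abs_divide)
          also have "\<dots> \<le> 1 / (1 * (\<bar>t\<bar> / 2))"
            using half t pi_gt3 by (intro frac_le mult_mono) auto
          finally show ?thesis by simp
        qed
        then show "norm (indicator {a..b} s *\<^sub>R sinc_kernel \<omega> (of_real s - of_real t)) \<le> indicator {a..b} s *\<^sub>R (2 / \<bar>t\<bar>)" for s
          by (auto simp: indicator_def)
        then show "integrable lebesgue (\<lambda>s. indicator {a..b} s *\<^sub>R sinc_kernel \<omega> (of_real s - of_real t))"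
          by (intro Bochner_Integration.integrable_bound[OF int borel_imp_lebesgue_measurable[OF meas]] AE_I2)
             (auto simp: indicator_def)
      qed
      also have "\<dots> = 2 * (b - a) / \<bar>t\<bar>"
        using assms by (simp add: set_lebesgue_integral_def)
      finally have "(norm ?G)\<^sup>2 \<le> (2 * (b - a) / \<bar>t\<bar>)\<^sup>2" by (intro power_mono) auto
      moreover have "1 + t\<^sup>2 \<le> 2 * t\<^sup>2" using t by (simp add: abs_le_square_iff[of 1 t, simplified])
      ultimately have "(norm ?G)\<^sup>2 * (1 + t\<^sup>2) \<le> (2 * (b - a) / \<bar>t\<bar>)\<^sup>2 * (2 * t\<^sup>2)"
        by (intro mult_mono) auto
      also have "\<dots> = (2 * (b - a))\<^sup>2 * 2" using t by (auto simp: power_divide)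
      finally show ?thesis by (simp add: C_def add_increasing)
    qed
    then show ?thesis using pos by (simp add: field_simps)
  qed
  then show thesis using that by blast
qed

text \<open>
  Integrating the reproducing formula over \<open>[a, b]\<close> moves the integral onto the kernel, by Fubini.
  As the bandwidth \<open>n\<close> tends to infinity the averaged kernel becomes the indicator function of
  \<open>[a, b]\<close>, while the other side stays constant; so both functions have the same integral over \<open>[a, b]\<close>.
\<close>

lemma band_limited_inversion:
  assumes f: "f \<in> L2 UNIV lebesgue" and ft: "has_fourier_transform f h"
    and supp: "ess_support h \<subseteq> {-\<rho>..\<rho>}" and \<rho>: "0 \<le> \<rho>"
  shows "AE t in lebesgue. f t = band_limited_extension \<rho> h (of_real t)"
proof -
  interpret pair_sigma_finite "lebesgue :: real measure" "lebesgue :: real measure"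
    by (rule pair_sigma_finite_lebesgue)
  note [measurable] = of_real_fst_measurable of_real_snd_measurable
  have [measurable]: "f \<in> borel_measurable lebesgue" using f by (simp add: L2_def)
  let ?g = "\<lambda>s. band_limited_extension \<rho> h (of_real s)"
  have h: "h \<in> L2 UNIV lebesgue" using ft by (simp add: has_fourier_transform_def)
  have "continuous_on UNIV ?g"
    by (intro continuous_on_compose2[OF holomorphic_on_imp_continuous_on[OF band_limited_extension_holomorphic[OF h]]]
        continuous_intros) auto
  then have "integrable lborel (\<lambda>s. indicator {a..b} s *\<^sub>R ?g s)" for a b
    by (rule borel_integrable_compact[OF compact_Icc continuous_on_subset[OF _ subset_UNIV]])
  then have g_int: "set_integrable lebesgue {a..b} ?g" for a b
    unfolding set_integrable_def by (subst integrable_completion) auto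
  have f_int: "set_integrable lebesgue {a..b} f" for a b by (rule L2_imp_set_integrable[OF f])
  have eq: "(LINT s:{a..b}|lebesgue. ?g s) = (LINT t:{a..b}|lebesgue. f t)" if ab: "a \<le> b" for a b
  proof -
    define G where "G n t = (LINT s:{a..b}|lebesgue. sinc_kernel (real n) (of_real s - of_real t))" for n t
    obtain C where C0: "\<And>\<omega> t. 0 < \<omega> \<Longrightarrow>
        (norm (LINT s:{a..b}|lebesgue. sinc_kernel \<omega> (of_real s - of_real t)))\<^sup>2 \<le> C * (1 / (1 + (0 - t)\<^sup>2))"
      using integrated_sinc_kernel_bound[OF ab] by blast
    have C: "(norm (G n t))\<^sup>2 \<le> C * (1 / (1 + (0 - t)\<^sup>2))" if "0 < n" for n t
      unfolding G_def by (rule C0) (use that in simp)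
    have swap: "(LINT s:{a..b}|lebesgue. ?g s) = (LINT t|lebesgue. f t * G n t)" if n: "\<rho> \<le> real n" for n
    proof -
      let ?S = "\<lambda>s t. sinc_kernel (real n) (of_real s - of_real t)"
      define P where "P s t = indicator {a..b} s *\<^sub>R (f t * ?S s t)" for s t
      define B where "B = (LINT t|lebesgue. (norm (f t))\<^sup>2) + (4 * (real n)\<^sup>2 + 1) * pi"
      have S_L2: "?S s \<in> L2 UNIV lebesgue" for s by (rule sinc_kernel_L2) simp
      have S_norm: "(LINT t|lebesgue. (norm (?S s t))\<^sup>2) \<le> (4 * (real n)\<^sup>2 + 1) * pi" for s
        using sinc_kernel_L2(2)[of "real n" "of_real s"] by simp
      have fS: "integrable lebesgue (\<lambda>t. f t * ?S s t)" for s by (rule L2_mult_integrable[OF f S_L2])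
      have inner: "(LINT t|lebesgue. norm (f t * ?S s t)) \<le> B" for s
      proof -
        have "(LINT t|lebesgue. norm (f t * ?S s t)) \<le> (LINT t|lebesgue. (norm (f t))\<^sup>2 + (norm (?S s t))\<^sup>2)"
          by (intro integral_mono integrable_norm[OF fS] Bochner_Integration.integrable_add
              L2_integrable_norm_sq[OF f] L2_integrable_norm_sq[OF S_L2] norm_mult_le_sum_squares)
        also have "\<dots> \<le> B"
          unfolding B_def
          using Bochner_Integration.integral_add[OF L2_integrable_norm_sq[OF f] L2_integrable_norm_sq[OF S_L2[of s]]]
            S_norm[of s] by simp
        finally show ?thesis .
      qed
      have [measurable]: "(\<lambda>p. indicator {a..b} (fst p) :: real) \<in> borel_measurable (lebesgue \<Otimes>\<^sub>M lebesgue)"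
        by (rule measurable_compose[OF measurable_fst]) (intro borel_measurable_indicator, simp)
      have "(\<lambda>p. P (fst p) (snd p)) \<in> borel_measurable (lebesgue \<Otimes>\<^sub>M lebesgue)"
        unfolding P_def by measurable
      then have P_meas: "case_prod P \<in> borel_measurable (lebesgue \<Otimes>\<^sub>M lebesgue)"
        by (simp add: case_prod_beta)
      have P: "integrable (lebesgue \<Otimes>\<^sub>M lebesgue) (case_prod P)"
      proof (rule Fubini_integrable[OF P_meas])
        have "integrable lebesgue (\<lambda>s. indicator {a..b} s *\<^sub>R B)"
          by (intro integrable_scaleR_left integrable_real_indicator) (auto simp: emeasure_lborel_Icc_eq)
        then show "integrable lebesgue (\<lambda>s. LINT t|lebesgue. norm (case_prod P (s, t)))"
        proof (rule Bochner_Integration.integrable_bound)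
          show "(\<lambda>s. LINT t|lebesgue. norm (case_prod P (s, t))) \<in> borel_measurable lebesgue"
            by (rule sigma_finite_measure.borel_measurable_lebesgue_integral[OF sigma_finite_lebesgue])
              (use P_meas in \<open>simp add: case_prod_beta\<close>)
          show "AE s in lebesgue. norm (LINT t|lebesgue. norm (case_prod P (s, t))) \<le> norm (indicator {a..b} s *\<^sub>R B)"
            using order_trans[OF inner abs_ge_self]
            by (intro AE_I2) (auto simp: P_def indicator_def norm_mult[symmetric] intro!: Bochner_Integration.integral_nonneg simp del: norm_mult)
        qed
        show "AE s in lebesgue. integrable lebesgue (\<lambda>t. case_prod P (s, t))"
          using fS by (auto simp: P_def)
      qed
      have "(LINT s:{a..b}|lebesgue. ?g s) = (LINT s|lebesgue. LINT t|lebesgue. P s t)"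
        unfolding set_lebesgue_integral_def P_def integral_scaleR_right
          sinc_kernel_reproduces[OF f ft supp \<rho> n] ..
      also have "\<dots> = (LINT t|lebesgue. LINT s|lebesgue. P s t)"
        using Fubini_integral[OF P] by simp
      also have "\<dots> = (LINT t|lebesgue. f t * G n t)"
        unfolding P_def G_def set_lebesgue_integral_def mult_scaleR_right[symmetric] integral_mult_right_zero ..
      finally show ?thesis .
    qed
    have G_formula: "G n t = of_real ((Si (2 * pi * real n * (b - t)) - Si (2 * pi * real n * (a - t))) / pi)" if "0 < n" for n t
      unfolding G_def using integral_sinc_kernel[OF ab] that by simp
    have "(\<lambda>n. LINT t|lebesgue. f t * G (Suc n) t) \<longlonglongrightarrow> (LINT t|lebesgue. f t * indicator {a..b} t)"
    proof (rule integral_dominated_convergence)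
      show "(\<lambda>t. f t * indicator {a..b} t) \<in> borel_measurable lebesgue"
        by (intro borel_measurable_times L2_measurable[OF f] borel_measurable_indicator) simp
      show "(\<lambda>t. f t * G (Suc n) t) \<in> borel_measurable lebesgue" for n
      proof -
        have "(\<lambda>t. complex_of_real ((Si (2 * pi * real (Suc n) * (b - t)) - Si (2 * pi * real (Suc n) * (a - t))) / pi)) \<in> borel_measurable lebesgue"
          by (rule borel_imp_lebesgue_measurable) measurable
        then show ?thesis
          unfolding G_formula[OF zero_less_Suc] by (intro borel_measurable_times L2_measurable[OF f])
      qed
      show "integrable lebesgue (\<lambda>t. (norm (f t))\<^sup>2 + C * (1 / (1 + (0 - t)\<^sup>2)))"
        by (intro Bochner_Integration.integrable_add integrable_mult_right Cauchy_density_integrable L2_integrable_norm_sq[OF f])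
      show "AE t in lebesgue. norm (f t * G (Suc n) t) \<le> (norm (f t))\<^sup>2 + C * (1 / (1 + (0 - t)\<^sup>2))" for n
        by (intro AE_I2 order_trans[OF norm_mult_le_sum_squares] add_left_mono C) simp
      have "AE t in lebesgue. t \<notin> {a, b}"
        by (intro AE_not_in null_sets_completionI finite_imp_null_set_lborel) simp
      then show "AE t in lebesgue. (\<lambda>n. f t * G (Suc n) t) \<longlonglongrightarrow> f t * indicator {a..b} t"
      proof eventually_elim
        case (elim t)
        have "(\<lambda>n. (Si (2 * pi * real n * (b - t)) - Si (2 * pi * real n * (a - t))) / pi) \<longlonglongrightarrow> indicator {a..b} t"
        proof -
          consider "t < a" | "a < t" "t < b" | "b < t" using elim by force
          then show ?thesis
          proof cases
            case 1
            then show ?thesis using ab tendsto_divide[OF tendsto_diff[OF Si_scale_tendsto_pos[of "b - t"] Si_scale_tendsto_pos[of "a - t"]] tendsto_const[of pi]]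
              by (simp add: indicator_def)
          next
            case 2
            then show ?thesis using ab tendsto_divide[OF tendsto_diff[OF Si_scale_tendsto_pos[of "b - t"] Si_scale_tendsto_neg[of "a - t"]] tendsto_const[of pi]]
              by (simp add: indicator_def)
          next
            case 3
            then show ?thesis using ab tendsto_divide[OF tendsto_diff[OF Si_scale_tendsto_neg[of "b - t"] Si_scale_tendsto_neg[of "a - t"]] tendsto_const[of pi]]
              by (simp add: indicator_def)
          qed
        qed
        from LIMSEQ_Suc[OF this] have "(\<lambda>n. complex_of_real ((Si (2 * pi * real (Suc n) * (b - t)) - Si (2 * pi * real (Suc n) * (a - t))) / pi))
            \<longlonglongrightarrow> complex_of_real (indicator {a..b} t)"
          by (rule tendsto_of_real)
        then show ?case
          unfolding G_formula[OF zero_less_Suc] of_real_indicator by (intro tendsto_mult tendsto_const)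
      qed
    qed
    moreover have "(\<lambda>n. LINT t|lebesgue. f t * G (Suc n) t) \<longlonglongrightarrow> (LINT s:{a..b}|lebesgue. ?g s)"
    proof (rule tendsto_eventually)
      obtain N :: nat where "\<rho> \<le> real N" using real_arch_simple by blast
      then show "\<forall>\<^sub>F n in sequentially. (LINT t|lebesgue. f t * G (Suc n) t) = (LINT s:{a..b}|lebesgue. ?g s)"
        unfolding eventually_sequentially by (intro exI[of _ N] allI impI swap[symmetric]) simp
    qed
    ultimately have "(LINT s:{a..b}|lebesgue. ?g s) = (LINT t|lebesgue. f t * indicator {a..b} t)"
      by (rule LIMSEQ_unique[rotated])
    also have "\<dots> = (LINT t:{a..b}|lebesgue. f t)"
      unfolding set_lebesgue_integral_def
      by (intro Bochner_Integration.integral_cong) (auto simp: indicator_def)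
    finally show ?thesis .
  qed
  have "AE t in lebesgue. f t - ?g t = 0"
    by (rule AE_zero_if_interval_integrals_zero) (auto intro!: set_integral_diff f_int g_int simp: eq set_integral_diff[OF f_int g_int])
  then show ?thesis by eventually_elim simp
qed

section \<open>Band-limited functions do not concentrate on sets of finite measure\<close>

text \<open>
  The form in which band-limitedness is used from here on: \<open>v\<close> agrees almost everywhere with an entire
  function \<open>g\<close>, whose values at all complex points are recovered from \<open>v\<close> by the kernel of bandwidth
  \<open>B\<close>. It passes to linear combinations, and the kernel turns bounds on the norm of \<open>v\<close> into
  pointwise bounds on \<open>g\<close>.
\<close>

definition reproduced_by_sinc :: "real \<Rightarrow> (real \<Rightarrow> complex) \<Rightarrow> (complex \<Rightarrow> complex) \<Rightarrow> bool" where
  "reproduced_by_sinc B v g \<longleftrightarrow> v \<in> L2 UNIV lebesgue \<and> g holomorphic_on UNIV \<and>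
     (AE t in lebesgue. v t = g (of_real t)) \<and>
     (\<forall>z. g z = (LINT u|lebesgue. v u * sinc_kernel B (z - of_real u)))"

lemma
  assumes "reproduced_by_sinc B v g"
  shows reproduced_by_sinc_L2: "v \<in> L2 UNIV lebesgue"
    and reproduced_by_sinc_holomorphic: "g holomorphic_on UNIV"
    and reproduced_by_sinc_AE: "AE t in lebesgue. v t = g (of_real t)"
    and reproduced_by_sinc_eq: "g z = (LINT u|lebesgue. v u * sinc_kernel B (z - of_real u))"
  using assms unfolding reproduced_by_sinc_def by blast+

lemma reproduced_by_sinc_scale:
  assumes "reproduced_by_sinc B v g"
  shows "reproduced_by_sinc B (\<lambda>t. c * v t) (\<lambda>z. c * g z)"
  unfolding reproduced_by_sinc_def
proof (intro conjI allI)
  show "AE t in lebesgue. c * v t = c * g (of_real t)"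
    using reproduced_by_sinc_AE[OF assms] by eventually_elim simp
  show "c * g z = (LINT u|lebesgue. c * v u * sinc_kernel B (z - of_real u))" for z
    unfolding mult.assoc integral_mult_right_zero reproduced_by_sinc_eq[OF assms, symmetric] ..
qed (intro L2_cmult holomorphic_intros reproduced_by_sinc_L2[OF assms] reproduced_by_sinc_holomorphic[OF assms])+

lemma reproduced_by_sinc_sum:
  assumes "0 \<le> B" "finite I" "\<And>i. i \<in> I \<Longrightarrow> reproduced_by_sinc B (v i) (g i)"
  shows "reproduced_by_sinc B (\<lambda>t. \<Sum>i\<in>I. v i t) (\<lambda>z. \<Sum>i\<in>I. g i z)"
  unfolding reproduced_by_sinc_def
proof (intro conjI allI)
  show "(\<lambda>t. \<Sum>i\<in>I. v i t) \<in> L2 UNIV lebesgue"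
    using assms by (intro L2_sum reproduced_by_sinc_L2)
  show "(\<lambda>z. \<Sum>i\<in>I. g i z) holomorphic_on UNIV"
    using assms by (intro holomorphic_intros reproduced_by_sinc_holomorphic)
  have "AE t in lebesgue. \<forall>i\<in>I. v i t = g i (of_real t)"
    using assms by (subst AE_ball_countable) (auto intro: countable_finite reproduced_by_sinc_AE)
  then show "AE t in lebesgue. (\<Sum>i\<in>I. v i t) = (\<Sum>i\<in>I. g i (of_real t))"
    by eventually_elim (auto intro!: sum.cong)
  fix z
  have "(LINT u|lebesgue. (\<Sum>i\<in>I. v i u) * sinc_kernel B (z - of_real u))
      = (LINT u|lebesgue. (\<Sum>i\<in>I. v i u * sinc_kernel B (z - of_real u)))"
    by (simp add: sum_distrib_right)
  also have "\<dots> = (\<Sum>i\<in>I. (LINT u|lebesgue. v i u * sinc_kernel B (z - of_real u)))"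
    using assms by (intro Bochner_Integration.integral_sum L2_mult_integrable[OF reproduced_by_sinc_L2 sinc_kernel_L2(1)])
  also have "\<dots> = (\<Sum>i\<in>I. g i z)"
    using assms by (intro sum.cong reproduced_by_sinc_eq[symmetric]) auto
  finally show "(\<Sum>i\<in>I. g i z) = (LINT u|lebesgue. (\<Sum>i\<in>I. v i u) * sinc_kernel B (z - of_real u))" ..
qed

lemma reproduced_by_sinc_bound:
  assumes "0 \<le> B" "reproduced_by_sinc B v g" "\<bar>Im z\<bar> \<le> Y"
    and "(LINT t|lebesgue. (norm (v t))\<^sup>2) \<le> 1"
  shows "norm (g z) \<le> sqrt ((4 * B\<^sup>2 + 1) * (exp (2 * pi * B * Y))\<^sup>2 * pi)"
proof (rule real_le_rsqrt)
  let ?S = "\<lambda>u. sinc_kernel B (z - of_real u)"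
  have "(norm (g z))\<^sup>2 = (norm (LINT u|lebesgue. v u * ?S u))\<^sup>2"
    by (simp only: reproduced_by_sinc_eq[OF assms(2)])
  also have "\<dots> \<le> (LINT t|lebesgue. (norm (v t))\<^sup>2) * (LINT u|lebesgue. (norm (?S u))\<^sup>2)"
    using assms by (intro Cauchy_Schwarz_L2 sinc_kernel_L2 reproduced_by_sinc_L2)
  also have "\<dots> \<le> 1 * (LINT u|lebesgue. (norm (?S u))\<^sup>2)"
    using assms by (intro mult_right_mono) auto
  also have "\<dots> \<le> (4 * B\<^sup>2 + 1) * (exp (2 * pi * B * \<bar>Im z\<bar>))\<^sup>2 * pi"
    using sinc_kernel_L2(2)[OF assms(1), of z] by simp
  also have "\<dots> \<le> (4 * B\<^sup>2 + 1) * (exp (2 * pi * B * Y))\<^sup>2 * pi"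
    using assms by (intro mult_right_mono mult_left_mono power_mono) (auto intro!: mult_left_mono)
  finally show "(norm (g z))\<^sup>2 \<le> (4 * B\<^sup>2 + 1) * (exp (2 * pi * B * Y))\<^sup>2 * pi" .
qed

text \<open>
  A nonconstant entire function has countably many zeros, but a set of positive measure is uncountable.
\<close>

lemma entire_AE_zero_imp_zero:
  assumes g: "g holomorphic_on UNIV"
    and S: "S \<in> sets lebesgue" "emeasure lebesgue S \<noteq> 0"
    and zero: "AE t in lebesgue. t \<in> S \<longrightarrow> g (of_real t) = 0"
  shows "g z = 0"
proof (rule ccontr)
  assume "g z \<noteq> 0"
  let ?Z = "{t::real. g (of_real t) = 0}"
  have "uncountable ?Z"
  proof
    assume "countable ?Z"
    then have "?Z \<in> null_sets lebesgue"
      by (intro null_sets_completionI countable_imp_null_set_lborel)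
    then have "AE t in lebesgue. t \<notin> ?Z" by (rule AE_not_in)
    with zero have "AE t in lebesgue. t \<notin> S" by eventually_elim auto
    with S show False by (simp add: AE_iff_measurable[OF S(1)])
  qed
  then obtain t0 where t0: "g (of_real t0) = 0" by (metis (mono_tags) Collect_empty_eq countable_empty)
  have "\<not> g constant_on UNIV"
    using t0 \<open>g z \<noteq> 0\<close> unfolding constant_on_def by (metis UNIV_I)
  then have "countable {w\<in>UNIV. g w = 0}"
    using g by (intro holomorphic_countable_zeros) auto
  moreover have "of_real ` ?Z \<subseteq> {w\<in>UNIV. g w = 0}" by auto
  ultimately have "countable (complex_of_real ` ?Z)" by (rule countable_subset[rotated])
  then have "countable ?Z" by (rule countable_image_inj_on) (auto simp: inj_on_def)
  with \<open>uncountable ?Z\<close> show False ..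
qed

text \<open>
  By contradiction: take \<open>v n\<close> of norm one with energy less than \<open>1 / (n + 1)\<close> outside \<open>A\<close>, and pass to a
  locally uniform limit \<open>G\<close> of their entire extensions. On the real line the extensions are bounded
  by a common constant, so no energy is lost on \<open>A\<close>, which has finite measure; on the complement Fatou's lemma
  forces \<open>G = 0\<close> almost everywhere, hence everywhere.
\<close>

theorem band_limited_concentration_gap:
  assumes B: "0 \<le> B" and A: "A \<in> sets lebesgue" "emeasure lebesgue A < \<infinity>"
  shows "\<exists>\<delta>>0. \<forall>v g. reproduced_by_sinc B v g \<longrightarrow>
           \<delta> * (LINT t|lebesgue. (norm (v t))\<^sup>2) \<le> (LINT t|lebesgue. indicator (- A) t * (norm (v t))\<^sup>2)"
proof (rule ccontr)
  assume neg: "\<not> ?thesis"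
  have neg': "\<exists>v g. reproduced_by_sinc B v g
      \<and> (LINT t|lebesgue. indicator (- A) t * (norm (v t))\<^sup>2) < \<delta> * (LINT t|lebesgue. (norm (v t))\<^sup>2)"
    if "0 < \<delta>" for \<delta>
  proof (rule ccontr)
    assume "\<not> ?thesis"
    then have "\<forall>v g. reproduced_by_sinc B v g \<longrightarrow>
        \<delta> * (LINT t|lebesgue. (norm (v t))\<^sup>2) \<le> (LINT t|lebesgue. indicator (- A) t * (norm (v t))\<^sup>2)"
      by (meson not_le)
    with neg that show False by blast
  qed
  have [measurable]: "A \<in> sets lebesgue" "- A \<in> sets lebesgue"
    using A by (simp_all add: Compl_in_sets_lebesgue)
  have int: "integrable lebesgue (\<lambda>t. (norm (v t))\<^sup>2)" if "reproduced_by_sinc B v g" for v g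
    by (intro L2_integrable_norm_sq[OF reproduced_by_sinc_L2[OF that]])
  have intA: "integrable lebesgue (\<lambda>t. indicator S t * (norm (v t))\<^sup>2)"
    if "reproduced_by_sinc B v g" "S \<in> sets lebesgue" for v g S
    using integrable_mult_indicator[OF that(2) int[OF that(1)]] by simp
  have "\<exists>v. (\<exists>g. reproduced_by_sinc B v g) \<and> (LINT t|lebesgue. (norm (v t))\<^sup>2) = 1
      \<and> (LINT t|lebesgue. indicator (- A) t * (norm (v t))\<^sup>2) < 1 / real (Suc n)" for n
  proof -
    obtain v g where vg: "reproduced_by_sinc B v g"
      "(LINT t|lebesgue. indicator (- A) t * (norm (v t))\<^sup>2) < 1 / real (Suc n) * (LINT t|lebesgue. (norm (v t))\<^sup>2)"
    proof -
      have "0 < 1 / real (Suc n)" by simp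
      from neg'[OF this] show ?thesis using that by blast
    qed
    define N where "N = (LINT t|lebesgue. (norm (v t))\<^sup>2)"
    have "0 \<le> (LINT t|lebesgue. indicator (- A) t * (norm (v t))\<^sup>2)" by (intro Bochner_Integration.integral_nonneg) auto
    then have "0 < 1 / real (Suc n) * N" using vg(2) unfolding N_def by linarith
    then have N: "0 < N" by (simp add: zero_less_mult_iff zero_less_divide_iff)
    define c where "c = complex_of_real (1 / sqrt N)"
    have c: "(norm (c * w))\<^sup>2 = (norm w)\<^sup>2 / N" for w
      using N by (simp add: c_def norm_mult norm_divide power_mult_distrib power_divide)
    have "reproduced_by_sinc B (\<lambda>t. c * v t) (\<lambda>z. c * g z)" by (rule reproduced_by_sinc_scale[OF vg(1)])
    moreover have "(LINT t|lebesgue. (norm (c * v t))\<^sup>2) = 1"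
      unfolding c using N by (simp add: N_def)
    moreover have "(LINT t|lebesgue. indicator (- A) t * (norm (c * v t))\<^sup>2) < 1 / real (Suc n)"
      unfolding c using vg(2) N by (simp add: N_def[symmetric] field_simps)
    ultimately show ?thesis by blast
  qed
  then obtain v where "\<forall>n. (\<exists>g. reproduced_by_sinc B (v n) g) \<and> (LINT t|lebesgue. (norm (v n t))\<^sup>2) = 1
      \<and> (LINT t|lebesgue. indicator (- A) t * (norm (v n t))\<^sup>2) < 1 / real (Suc n)"
    by (rule choice[OF allI, THEN exE])
  then have "\<forall>n. \<exists>g. reproduced_by_sinc B (v n) g"
    and norm1: "\<And>n. (LINT t|lebesgue. (norm (v n t))\<^sup>2) = 1"
    and small: "\<And>n. (LINT t|lebesgue. indicator (- A) t * (norm (v n t))\<^sup>2) < 1 / real (Suc n)"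
    by blast+
  then obtain g where vg: "\<And>n. reproduced_by_sinc B (v n) (g n)" by metis
  define C where "C Y = sqrt ((4 * B\<^sup>2 + 1) * (exp (2 * pi * B * Y))\<^sup>2 * pi)" for Y
  have bound: "norm (g n z) \<le> C Y" if "\<bar>Im z\<bar> \<le> Y" for n z Y
    unfolding C_def by (rule reproduced_by_sinc_bound[OF B vg that]) (simp add: norm1)
  have hol: "g n holomorphic_on UNIV" for n by (rule reproduced_by_sinc_holomorphic[OF vg])
  obtain G r where G: "G holomorphic_on UNIV" and r: "strict_mono (r :: nat \<Rightarrow> nat)"
    and lim: "\<And>z. (\<lambda>n. g (r n) z) \<longlonglongrightarrow> G z"
  proof (rule Montel[of UNIV "range g" g])
    show "\<exists>M. \<forall>h\<in>range g. \<forall>z\<in>K. norm (h z) \<le> M" if "compact K" for K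
    proof -
      obtain Y where Y: "\<And>z. z \<in> K \<Longrightarrow> norm z \<le> Y"
        using compact_imp_bounded[OF \<open>compact K\<close>] by (auto simp: bounded_iff)
      have "norm (g n z) \<le> C Y" if "z \<in> K" for n z
        by (rule bound[OF order_trans[OF abs_Im_le_cmod Y[OF that]]])
      then show ?thesis by blast
    qed
  qed (use hol in auto)
  have v_eq: "AE t in lebesgue. \<forall>n. v n t = g n (of_real t)"
    using vg by (subst AE_all_countable) (blast intro: reproduced_by_sinc_AE)
  have [measurable]: "v n \<in> borel_measurable lebesgue" for n
    by (intro L2_measurable[OF reproduced_by_sinc_L2[OF vg]])
  have "continuous_on UNIV (\<lambda>t. G (of_real t))"
    by (intro continuous_on_compose2[OF holomorphic_on_imp_continuous_on[OF G]] continuous_intros) auto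
  then have [measurable]: "(\<lambda>t. G (complex_of_real t)) \<in> borel_measurable lebesgue"
    by (intro borel_imp_lebesgue_measurable borel_measurable_continuous_onI)
  have lim_v: "AE t in lebesgue. (\<lambda>n. (norm (v (r n) t))\<^sup>2) \<longlonglongrightarrow> (norm (G (of_real t)))\<^sup>2"
    using v_eq by eventually_elim (auto intro!: tendsto_intros lim)
  have split: "(LINT t|lebesgue. indicator A t * (norm (v n t))\<^sup>2) > 1 - 1 / real (Suc n)" for n
  proof -
    have "(LINT t|lebesgue. indicator A t * (norm (v n t))\<^sup>2) + (LINT t|lebesgue. indicator (- A) t * (norm (v n t))\<^sup>2)
        = (LINT t|lebesgue. indicator A t * (norm (v n t))\<^sup>2 + indicator (- A) t * (norm (v n t))\<^sup>2)"
      by (rule Bochner_Integration.integral_add[symmetric]; rule intA[OF vg]) fact+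
    also have "\<dots> = (LINT t|lebesgue. (norm (v n t))\<^sup>2)"
      by (intro Bochner_Integration.integral_cong) (auto simp: indicator_def)
    finally show ?thesis using norm1[of n] small[of n] by linarith
  qed
  have inv: "(\<lambda>n. 1 / real (Suc (r n))) \<longlonglongrightarrow> 0"
    using LIMSEQ_subseq_LIMSEQ[OF LIMSEQ_inverse_real_of_nat r] by (simp add: o_def inverse_eq_divide)
  have lim_A: "(\<lambda>n. LINT t|lebesgue. indicator A t * (norm (v (r n) t))\<^sup>2) \<longlonglongrightarrow> (LINT t|lebesgue. indicator A t * (norm (G (of_real t)))\<^sup>2)"
  proof (rule integral_dominated_convergence)
    show "integrable lebesgue (\<lambda>t. indicator A t * (C 0)\<^sup>2)"
      using A by (intro integrable_mult_left integrable_real_indicator) auto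
    show "AE t in lebesgue. (\<lambda>n. indicator A t * (norm (v (r n) t))\<^sup>2) \<longlonglongrightarrow> indicator A t * (norm (G (of_real t)))\<^sup>2"
      using lim_v by eventually_elim (auto intro!: tendsto_intros)
    show "AE t in lebesgue. norm (indicator A t * (norm (v (r n) t))\<^sup>2) \<le> indicator A t * (C 0)\<^sup>2" for n
      using v_eq by eventually_elim (auto simp: indicator_def intro!: power_mono bound)
  qed measurable
  have lim_1: "(\<lambda>n. 1 - 1 / real (Suc (r n))) \<longlonglongrightarrow> 1"
    using tendsto_diff[OF tendsto_const[of 1] inv] by simp
  have one: "1 \<le> (LINT t|lebesgue. indicator A t * (norm (G (of_real t)))\<^sup>2)"
    by (rule LIMSEQ_le[OF lim_1 lim_A]) (intro exI allI impI less_imp_le split)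
  have "(\<integral>\<^sup>+t. indicator (- A) t * ennreal ((norm (G (of_real t)))\<^sup>2) \<partial>lebesgue)
      = (\<integral>\<^sup>+t. liminf (\<lambda>n. indicator (- A) t * ennreal ((norm (v (r n) t))\<^sup>2)) \<partial>lebesgue)"
  proof (rule nn_integral_cong_AE)
    show "AE t in lebesgue. indicator (- A) t * ennreal ((norm (G (of_real t)))\<^sup>2)
        = liminf (\<lambda>n. indicator (- A) t * ennreal ((norm (v (r n) t))\<^sup>2))"
      using lim_v
    proof eventually_elim
      case (elim t)
      then have "(\<lambda>n. indicator (- A) t * ennreal ((norm (v (r n) t))\<^sup>2)) \<longlonglongrightarrow> indicator (- A) t * ennreal ((norm (G (of_real t)))\<^sup>2)"
        by (intro ennreal_tendsto_cmult tendsto_ennrealI) (auto simp: indicator_def)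
      then show ?case by (simp add: lim_imp_Liminf)
    qed
  qed
  also have "\<dots> \<le> liminf (\<lambda>n. \<integral>\<^sup>+t. indicator (- A) t * ennreal ((norm (v (r n) t))\<^sup>2) \<partial>lebesgue)"
    by (rule nn_integral_liminf) measurable
  also have "\<dots> \<le> liminf (\<lambda>n. ennreal (1 / real (Suc (r n))))"
  proof (intro Liminf_mono always_eventually allI)
    fix n
    have "(\<integral>\<^sup>+t. indicator (- A) t * ennreal ((norm (v (r n) t))\<^sup>2) \<partial>lebesgue)
        = (\<integral>\<^sup>+t. ennreal (indicator (- A) t * (norm (v (r n) t))\<^sup>2) \<partial>lebesgue)"
      by (intro nn_integral_cong) (auto simp: indicator_def)
    also have "\<dots> = ennreal (LINT t|lebesgue. indicator (- A) t * (norm (v (r n) t))\<^sup>2)"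
      by (rule nn_integral_eq_integral[OF intA[OF vg]]) (fact | auto)+
    also have "\<dots> \<le> ennreal (1 / real (Suc (r n)))"
      using small[of "r n"] by (intro ennreal_leI) simp
    finally show "(\<integral>\<^sup>+t. indicator (- A) t * ennreal ((norm (v (r n) t))\<^sup>2) \<partial>lebesgue) \<le> ennreal (1 / real (Suc (r n)))" .
  qed
  also have "\<dots> = 0"
    using tendsto_ennrealI[OF inv] by (simp add: lim_imp_Liminf)
  finally have "(\<integral>\<^sup>+t. indicator (- A) t * ennreal ((norm (G (of_real t)))\<^sup>2) \<partial>lebesgue) = 0" by simp
  then have "AE t in lebesgue. t \<in> - A \<longrightarrow> G (of_real t) = 0"
    by (subst (asm) nn_integral_0_iff_AE) (auto simp: indicator_def elim!: AE_mp)
  moreover have "emeasure lebesgue (- A) \<noteq> 0"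
  proof
    assume "emeasure lebesgue (- A) = 0"
    moreover have "emeasure lebesgue UNIV \<le> emeasure lebesgue A + emeasure lebesgue (- A)"
      using emeasure_subadditive[of A lebesgue "- A"] A by (simp add: Compl_in_sets_lebesgue Compl_partition)
    ultimately show False using A by (simp add: top_unique)
  qed
  ultimately have "G z = 0" for z
    using entire_AE_zero_imp_zero[OF G, of "- A"] A by (simp add: Compl_in_sets_lebesgue)
  with one show False by simp
qed

section \<open>Moment problems for families with a lower Riesz bound on a set\<close>

text \<open>
  A family \<open>e\<close> with an upper frame bound \<open>\<beta>\<close> whose restriction to \<open>E\<close> has a lower Riesz bound \<open>\<kappa>\<close>.
  The condition \<open>1 \<le> \<kappa> * \<beta>\<close> can always be met by enlarging \<open>\<kappa>\<close>; it makes
  \<open>1 - 1 / (\<kappa> * \<beta>)\<close> nonnegative.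
\<close>

locale restricted_riesz_family =
  fixes K :: "complex set" and e :: "'i \<Rightarrow> real \<Rightarrow> complex" and \<Lambda> :: "'i set"
    and E :: "real set" and \<beta> \<kappa> :: real
  assumes K: "scalar_field K"
    and e: "\<And>i. i \<in> \<Lambda> \<Longrightarrow> e i \<in> L2 K lebesgue"
    and E: "E \<in> sets lebesgue"
    and \<beta>: "0 < \<beta>" and \<kappa>: "0 < \<kappa>" and \<kappa>\<beta>: "1 \<le> \<kappa> * \<beta>"
    and bessel_summable: "\<And>x. x \<in> L2 K lebesgue \<Longrightarrow> (\<lambda>i. (norm (L2_inner x (e i)))\<^sup>2) summable_on \<Lambda>"
    and bessel_le: "\<And>x. x \<in> L2 K lebesgue \<Longrightarrow>
      (\<Sum>\<^sub>\<infinity>i\<in>\<Lambda>. (norm (L2_inner x (e i)))\<^sup>2) \<le> \<beta> * (LINT t|lebesgue. (norm (x t))\<^sup>2)"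
    and lower: "\<And>F c. finite F \<Longrightarrow> F \<subseteq> \<Lambda> \<Longrightarrow> (\<And>i. i \<in> F \<Longrightarrow> c i \<in> K) \<Longrightarrow>
      (\<Sum>i\<in>F. (norm (c i))\<^sup>2) \<le> \<kappa> * (LINT t|lebesgue. indicator E t * (norm (\<Sum>i\<in>F. c i * e i t))\<^sup>2)"
begin

text \<open>
  Let \<open>g\<close> be the combination with coefficients \<open>c\<close>, cut off outside \<open>E\<close>, and \<open>z = g / \<beta>\<close>. Expanding
  the square, the cross terms add up to \<open>G = \<parallel>g\<parallel>\<^sup>2\<close>, and the frame bound gives at most \<open>N - G / \<beta>\<close>
  for the squared norm of the residual, where \<open>N\<close> is that of \<open>c\<close>. The factor \<open>1 / \<beta>\<close> is the one that minimises
  this bound. Nonnegativity of the residual yields \<open>G \<le> \<beta> * N\<close>, hence the bound on \<open>z\<close>, and the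
  lower Riesz bound \<open>N \<le> \<kappa> * G\<close> yields the contraction.
\<close>

lemma finite_coefficients_residual:
  assumes F: "finite F" "F \<subseteq> \<Lambda>" and c: "\<And>i. i \<in> F \<Longrightarrow> c i \<in> K"
  obtains z where "z \<in> L2 K lebesgue" "\<And>t. t \<notin> E \<Longrightarrow> z t = 0"
    "(LINT t|lebesgue. (norm (z t))\<^sup>2) \<le> 1 / \<beta> * (\<Sum>i\<in>F. (norm (c i))\<^sup>2)"
    "(\<lambda>i. (norm ((if i \<in> F then c i else 0) - L2_inner z (e i)))\<^sup>2) summable_on \<Lambda>"
    "(\<Sum>\<^sub>\<infinity>i\<in>\<Lambda>. (norm ((if i \<in> F then c i else 0) - L2_inner z (e i)))\<^sup>2)
       \<le> (1 - 1 / (\<kappa> * \<beta>)) * (\<Sum>i\<in>F. (norm (c i))\<^sup>2)"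
proof
  let ?c = "\<lambda>i. if i \<in> F then c i else 0"
  define v where "v t = (\<Sum>i\<in>F. c i * e i t)" for t
  define g where "g t = indicator E t * v t" for t
  define z where "z t = of_real (1 / \<beta>) * g t" for t
  have e': "e i \<in> L2 UNIV lebesgue" if "i \<in> F" for i using e F that L2_mono by blast
  have v: "v \<in> L2 UNIV lebesgue" unfolding v_def by (intro L2_sum L2_cmult e')
  have v_K: "v t \<in> K" for t
    unfolding v_def using F e
    by (intro scalar_field_sum[OF K] scalar_field_mult[OF K] c) (auto simp: L2_def)
  have g: "g \<in> L2 UNIV lebesgue" unfolding g_def by (rule L2_restrict[OF v E]) simp
  have g_K: "g t \<in> K" for t
    using v_K scalar_field_0[OF K] by (simp add: g_def indicator_def)
  have gK: "g \<in> L2 K lebesgue" using g g_K by (subst L2_scalars_iff) auto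
  show z: "z \<in> L2 K lebesgue"
    unfolding z_def
    using L2_cmult[OF g] g_K by (subst L2_scalars_iff) (auto intro!: scalar_field_mult[OF K] scalar_field_of_real[OF K] simp del: of_real_divide of_real_1)
  show "z t = 0" if "t \<notin> E" for t using that by (simp add: z_def g_def)
  define N where "N = (\<Sum>i\<in>F. (norm (c i))\<^sup>2)"
  define G where "G = (LINT t|lebesgue. (norm (g t))\<^sup>2)"
  define a where "a i = L2_inner g (e i)" for i
  have az: "L2_inner z (e i) = of_real (1 / \<beta>) * a i" for i
    unfolding z_def a_def by (rule L2_inner_cmult_left)
  have expand: "(norm (x - of_real (1 / \<beta>) * y))\<^sup>2 = (norm x)\<^sup>2 - 2 / \<beta> * Re (cnj x * y) + (1 / \<beta>)\<^sup>2 * (norm y)\<^sup>2" for x y :: complex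
    unfolding cmod_power2 by (simp add: power2_eq_square algebra_simps)
  have cross: "(\<Sum>i\<in>F. Re (cnj (c i) * a i)) = G"
  proof -
    have "(\<Sum>i\<in>F. cnj (c i) * a i) = L2_inner g v"
      unfolding v_def a_def by (rule L2_inner_sum_right[OF e' g, symmetric])
    also have "\<dots> = of_real G"
      unfolding L2_inner_def G_def integral_complex_of_real[symmetric]
      by (intro Bochner_Integration.integral_cong)
        (auto simp: g_def indicator_def complex_norm_square simp flip: of_real_power)
    finally have "Re (\<Sum>i\<in>F. cnj (c i) * a i) = G" by simp
    then show ?thesis by (simp only: Re_sum)
  qed
  have finite_sum: "((\<lambda>i. f (?c i) i) has_sum (\<Sum>i\<in>F. f (c i) i)) \<Lambda>" if "\<And>i. f 0 i = 0" for f :: "complex \<Rightarrow> 'i \<Rightarrow> real"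
  proof (rule has_sum_finite_neutralI[OF F])
    show "(\<Sum>i\<in>F. f (c i) i) = (\<Sum>i\<in>F. f (?c i) i)" by (intro sum.cong) auto
  qed (use that in auto)
  have a_sum: "((\<lambda>i. (norm (a i))\<^sup>2) has_sum (\<Sum>\<^sub>\<infinity>i\<in>\<Lambda>. (norm (a i))\<^sup>2)) \<Lambda>"
    unfolding a_def by (intro has_sum_infsum bessel_summable gK)
  have a_le: "(\<Sum>\<^sub>\<infinity>i\<in>\<Lambda>. (norm (a i))\<^sup>2) \<le> \<beta> * G"
    unfolding a_def G_def by (rule bessel_le[OF gK])
  have "((\<lambda>i. (norm (?c i))\<^sup>2 + - (2 / \<beta>) * Re (cnj (?c i) * a i) + (1 / \<beta>)\<^sup>2 * (norm (a i))\<^sup>2) has_sum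
      (N + - (2 / \<beta>) * G + (1 / \<beta>)\<^sup>2 * (\<Sum>\<^sub>\<infinity>i\<in>\<Lambda>. (norm (a i))\<^sup>2))) \<Lambda>"
    unfolding N_def cross[symmetric]
    by (intro has_sum_add has_sum_cmult_right a_sum
        finite_sum[of "\<lambda>x i. (norm x)\<^sup>2"] finite_sum[of "\<lambda>x i. Re (cnj x * a i)"]) auto
  then have total: "((\<lambda>i. (norm (?c i - L2_inner z (e i)))\<^sup>2) has_sum
      (N + - (2 / \<beta>) * G + (1 / \<beta>)\<^sup>2 * (\<Sum>\<^sub>\<infinity>i\<in>\<Lambda>. (norm (a i))\<^sup>2))) \<Lambda>"
    unfolding az expand by simp
  then show "(\<lambda>i. (norm (?c i - L2_inner z (e i)))\<^sup>2) summable_on \<Lambda>" by (rule has_sum_imp_summable)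
  have "(1 / \<beta>)\<^sup>2 * (\<Sum>\<^sub>\<infinity>i\<in>\<Lambda>. (norm (a i))\<^sup>2) \<le> (1 / \<beta>)\<^sup>2 * (\<beta> * G)"
    by (intro mult_left_mono a_le) simp
  also have "\<dots> = 1 / \<beta> * G" using \<beta> by (simp add: power2_eq_square)
  finally have total_le: "(\<Sum>\<^sub>\<infinity>i\<in>\<Lambda>. (norm (?c i - L2_inner z (e i)))\<^sup>2) \<le> N - 1 / \<beta> * G"
    unfolding infsumI[OF total] by (simp add: field_simps)
  have "0 \<le> (\<Sum>\<^sub>\<infinity>i\<in>\<Lambda>. (norm (?c i - L2_inner z (e i)))\<^sup>2)" by (intro infsum_nonneg) simp
  with total_le have "1 / \<beta> * G \<le> N" by linarith
  then have "1 / \<beta> * (1 / \<beta> * G) \<le> 1 / \<beta> * N"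
    using \<beta> by (intro mult_left_mono) auto
  moreover have "(LINT t|lebesgue. (norm (z t))\<^sup>2) = (1 / \<beta>)\<^sup>2 * G"
    unfolding z_def G_def norm_mult power_mult_distrib norm_of_real using \<beta> by simp
  then have "(LINT t|lebesgue. (norm (z t))\<^sup>2) = 1 / \<beta> * (1 / \<beta> * G)"
    by (simp add: power2_eq_square)
  ultimately show "(LINT t|lebesgue. (norm (z t))\<^sup>2) \<le> 1 / \<beta> * (\<Sum>i\<in>F. (norm (c i))\<^sup>2)"
    unfolding N_def by simp
  have "(norm (g t))\<^sup>2 = indicator E t * (norm (v t))\<^sup>2" for t
    by (simp add: g_def indicator_def)
  then have "N \<le> \<kappa> * G"
    unfolding N_def G_def v_def using lower[OF F c] by simp
  then have "1 / (\<kappa> * \<beta>) * N \<le> 1 / \<beta> * G"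
    using \<kappa> \<beta> by (simp add: field_simps)
  then show "(\<Sum>\<^sub>\<infinity>i\<in>\<Lambda>. (norm (?c i - L2_inner z (e i)))\<^sup>2) \<le> (1 - 1 / (\<kappa> * \<beta>)) * (\<Sum>i\<in>F. (norm (c i))\<^sup>2)"
    using total_le unfolding N_def[symmetric] by (simp add: left_diff_distrib)
qed

abbreviation energy :: "('i \<Rightarrow> complex) \<Rightarrow> real" where
  "energy r \<equiv> (\<Sum>\<^sub>\<infinity>i\<in>\<Lambda>. (norm (r i))\<^sup>2)"

definition contraction :: real where
  "contraction = 1 - 1 / (4 * (\<kappa> * \<beta>))"

lemma contraction_bounds: "0 < contraction" "contraction < 1"
  using \<kappa>\<beta> by (simp_all add: contraction_def divide_less_eq)

text \<open>
  The data \<open>r\<close> are first replaced by finitely many of them, up to a relative error \<open>\<epsilon>\<close> in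
  squared norm; the rest is absorbed into the contraction factor, which worsens from \<open>1 - \<theta>\<close> to
  \<open>1 - \<theta> / 4\<close>, where \<open>\<theta> = 1 / (\<kappa> * \<beta>)\<close>.
\<close>

lemma residual_step:
  assumes r: "r \<in> ell2 K \<Lambda>"
  shows "\<exists>z. z \<in> L2 K lebesgue \<and> (\<forall>t. t \<notin> E \<longrightarrow> z t = 0) \<and>
    (LINT t|lebesgue. (norm (z t))\<^sup>2) \<le> 1 / \<beta> * energy r \<and>
    (\<lambda>i. r i - L2_inner z (e i)) \<in> ell2 K \<Lambda> \<and>
    energy (\<lambda>i. r i - L2_inner z (e i)) \<le> contraction * energy r"
proof -
  define \<theta> where "\<theta> = 1 / (\<kappa> * \<beta>)"
  have \<theta>: "0 < \<theta>" "\<theta> \<le> 1" using \<kappa> \<beta> \<kappa>\<beta> by (simp_all add: \<theta>_def)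
  \<comment> \<open>Chosen so that \<open>(1 + 2 / \<theta>) * \<epsilon> = \<theta> / 4\<close>; here \<open>1 + 2 / \<theta>\<close> is the weight that
     goes with the weight \<open>1 + \<theta> / 2\<close> on the contracted part.\<close>
  define \<epsilon> where "\<epsilon> = \<theta>\<^sup>2 / (4 * (\<theta> + 2))"
  have \<epsilon>: "0 < \<epsilon>" using \<theta> by (simp add: \<epsilon>_def)
  have r_sum: "((\<lambda>i. (norm (r i))\<^sup>2) has_sum energy r) \<Lambda>"
    using r by (auto simp: ell2_def)
  have r_nonneg: "0 \<le> energy r" by (intro infsum_nonneg) simp
  obtain F where F: "finite F" "F \<subseteq> \<Lambda>" and tail: "energy r - (\<Sum>i\<in>F. (norm (r i))\<^sup>2) \<le> \<epsilon> * energy r"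
  proof (cases "energy r = 0")
    case True
    with that[of "{}"] show thesis by simp
  next
    case False
    then have "0 < \<epsilon> * energy r" using \<epsilon> r_nonneg by simp
    with r_sum have "\<forall>\<^sub>F F in finite_subsets_at_top \<Lambda>. dist (\<Sum>i\<in>F. (norm (r i))\<^sup>2) (energy r) < \<epsilon> * energy r"
      unfolding has_sum_def tendsto_iff by blast
    then obtain F where "finite F" "F \<subseteq> \<Lambda>" "dist (\<Sum>i\<in>F. (norm (r i))\<^sup>2) (energy r) < \<epsilon> * energy r"
      unfolding eventually_finite_subsets_at_top by blast
    with that[of F] show thesis by (simp add: dist_real_def abs_less_iff)
  qed
  have r_K: "r i \<in> K" if "i \<in> \<Lambda>" for i using r that by (auto simp: ell2_def)
  have F_K: "r i \<in> K" if "i \<in> F" for i using r_K F that by blast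
  let ?c = "\<lambda>i. if i \<in> F then r i else 0"
  obtain z where z: "z \<in> L2 K lebesgue" "\<And>t. t \<notin> E \<Longrightarrow> z t = 0"
    "(LINT t|lebesgue. (norm (z t))\<^sup>2) \<le> 1 / \<beta> * (\<Sum>i\<in>F. (norm (r i))\<^sup>2)"
    "(\<lambda>i. (norm (?c i - L2_inner z (e i)))\<^sup>2) summable_on \<Lambda>"
    "(\<Sum>\<^sub>\<infinity>i\<in>\<Lambda>. (norm (?c i - L2_inner z (e i)))\<^sup>2) \<le> (1 - 1 / (\<kappa> * \<beta>)) * (\<Sum>i\<in>F. (norm (r i))\<^sup>2)"
    by (rule finite_coefficients_residual[OF F, of r]) (erule F_K, rule that)
  have F_le: "(\<Sum>i\<in>F. (norm (r i))\<^sup>2) \<le> energy r"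
    using r_sum F by (intro finite_sum_le_infsum) (auto intro: has_sum_imp_summable)
  let ?d = "\<lambda>i. if i \<in> F then 0 else r i"
  have d_sum: "((\<lambda>i. (norm (?d i))\<^sup>2) has_sum (energy r - (\<Sum>i\<in>F. (norm (r i))\<^sup>2))) \<Lambda>"
  proof -
    have "((\<lambda>i. (norm (?c i))\<^sup>2) has_sum (\<Sum>i\<in>F. (norm (r i))\<^sup>2)) \<Lambda>"
      by (rule has_sum_finite_neutralI[OF F]) auto
    then have "((\<lambda>i. (norm (r i))\<^sup>2 + -1 * (norm (?c i))\<^sup>2) has_sum (energy r + -1 * (\<Sum>i\<in>F. (norm (r i))\<^sup>2))) \<Lambda>"
      by (intro has_sum_add has_sum_cmult_right r_sum)
    moreover have "(\<lambda>i. (norm (r i))\<^sup>2 + -1 * (norm (?c i))\<^sup>2) = (\<lambda>i. (norm (?d i))\<^sup>2)" by auto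
    ultimately show ?thesis by simp
  qed
  let ?s = "\<theta> / 2"
  let ?R = "(\<Sum>\<^sub>\<infinity>i\<in>\<Lambda>. (norm (?c i - L2_inner z (e i)))\<^sup>2)"
  have majorant: "((\<lambda>i. (1 + ?s) * (norm (?c i - L2_inner z (e i)))\<^sup>2 + (1 + 1 / ?s) * (norm (?d i))\<^sup>2) has_sum
      ((1 + ?s) * ?R + (1 + 1 / ?s) * (energy r - (\<Sum>i\<in>F. (norm (r i))\<^sup>2)))) \<Lambda>"
    by (intro has_sum_add has_sum_cmult_right d_sum has_sum_infsum z(4))
  have pointwise: "(norm (r i - L2_inner z (e i)))\<^sup>2
      \<le> (1 + ?s) * (norm (?c i - L2_inner z (e i)))\<^sup>2 + (1 + 1 / ?s) * (norm (?d i))\<^sup>2" for i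
  proof -
    have split: "r i - L2_inner z (e i) = (?c i - L2_inner z (e i)) + ?d i" by simp
    show ?thesis by (subst split, rule norm_add_sq_le_weighted) (use \<theta> in simp)
  qed
  have summable: "(\<lambda>i. (norm (r i - L2_inner z (e i)))\<^sup>2) summable_on \<Lambda>"
    by (rule summable_on_comparison_test[OF has_sum_imp_summable[OF majorant] pointwise]) simp
  have "energy (\<lambda>i. r i - L2_inner z (e i))
      \<le> (1 + ?s) * ?R + (1 + 1 / ?s) * (energy r - (\<Sum>i\<in>F. (norm (r i))\<^sup>2))"
    by (rule has_sum_mono[OF has_sum_infsum[OF summable] majorant pointwise])
  also have "\<dots> \<le> (1 + ?s) * ((1 - \<theta>) * energy r) + (1 + 1 / ?s) * (\<epsilon> * energy r)"
  proof (intro add_mono mult_left_mono tail)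
    show "?R \<le> (1 - \<theta>) * energy r"
      using z(5) mult_left_mono[OF F_le, of "1 - \<theta>"] \<theta> by (simp add: \<theta>_def)
  qed (use \<theta> in auto)
  also have "\<dots> = ((1 + ?s) * (1 - \<theta>) + (1 + 1 / ?s) * \<epsilon>) * energy r"
    by (subst distrib_right) (simp only: mult.assoc)
  also have "(1 + 1 / ?s) * \<epsilon> = \<theta> / 4"
  proof -
    have "1 + 1 / ?s = (\<theta> + 2) / \<theta>" using \<theta> by (simp add: field_simps)
    moreover have "\<theta> \<noteq> 0" "\<theta> + 2 \<noteq> 0" using \<theta> by auto
    ultimately show ?thesis by (simp add: \<epsilon>_def power2_eq_square divide_simps)
  qed
  also have "((1 + ?s) * (1 - \<theta>) + \<theta> / 4) * energy r \<le> contraction * energy r"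
  proof (rule mult_right_mono[OF _ r_nonneg])
    have "(1 + ?s) * (1 - \<theta>) + \<theta> / 4 = 1 - \<theta> / 4 - \<theta>\<^sup>2 / 2"
      by (simp add: power2_eq_square field_simps)
    also have "\<dots> \<le> 1 - \<theta> / 4" by simp
    also have "\<dots> = contraction" by (simp add: contraction_def \<theta>_def)
    finally show "(1 + ?s) * (1 - \<theta>) + \<theta> / 4 \<le> contraction" .
  qed
  finally have decrease: "energy (\<lambda>i. r i - L2_inner z (e i)) \<le> contraction * energy r" .
  have "(\<lambda>i. r i - L2_inner z (e i)) \<in> ell2 K \<Lambda>"
    using summable r_K L2_inner_scalar[OF K z(1) e]
    by (auto simp: ell2_def intro!: scalar_field_diff[OF K])
  moreover have "(LINT t|lebesgue. (norm (z t))\<^sup>2) \<le> 1 / \<beta> * energy r"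
    by (rule order_trans[OF z(3) mult_left_mono[OF F_le]]) (use \<beta> in simp)
  ultimately show ?thesis using z(1,2) decrease by blast
qed

text \<open>
  Iterating the preceding step makes the residuals decay geometrically, so the corrections do too and
  their series converges; its scalar products with the family telescope to \<open>\<eta>\<close>.
\<close>

theorem moment_problem_solvable:
  assumes \<eta>: "\<eta> \<in> ell2 K \<Lambda>"
  shows "\<exists>w\<in>L2 K lebesgue. (\<forall>t. t \<notin> E \<longrightarrow> w t = 0) \<and> (\<forall>i\<in>\<Lambda>. L2_inner w (e i) = \<eta> i)"
proof -
  let ?next = "\<lambda>r z i. r i - L2_inner z (e i)"
  obtain Z where "\<forall>r\<in>ell2 K \<Lambda>. Z r \<in> L2 K lebesgue \<and> (\<forall>t. t \<notin> E \<longrightarrow> Z r t = 0) \<and>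
      (LINT t|lebesgue. (norm (Z r t))\<^sup>2) \<le> 1 / \<beta> * energy r \<and>
      ?next r (Z r) \<in> ell2 K \<Lambda> \<and> energy (?next r (Z r)) \<le> contraction * energy r"
    by (rule bchoice[OF ballI[OF residual_step], THEN exE])
  then have Z: "\<And>r. r \<in> ell2 K \<Lambda> \<Longrightarrow> Z r \<in> L2 K lebesgue"
      "\<And>r t. r \<in> ell2 K \<Lambda> \<Longrightarrow> t \<notin> E \<Longrightarrow> Z r t = 0"
      "\<And>r. r \<in> ell2 K \<Lambda> \<Longrightarrow> (LINT t|lebesgue. (norm (Z r t))\<^sup>2) \<le> 1 / \<beta> * energy r"
      "\<And>r. r \<in> ell2 K \<Lambda> \<Longrightarrow> ?next r (Z r) \<in> ell2 K \<Lambda>"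
      "\<And>r. r \<in> ell2 K \<Lambda> \<Longrightarrow> energy (?next r (Z r)) \<le> contraction * energy r"
    by blast+
  define R where "R = rec_nat \<eta> (\<lambda>n r. ?next r (Z r))"
  have R_0: "R 0 = \<eta>" and R_Suc: "R (Suc n) = ?next (R n) (Z (R n))" for n
    by (simp_all add: R_def)
  have R: "R n \<in> ell2 K \<Lambda>" for n
    by (induction n) (simp_all only: R_0 R_Suc \<eta> Z(4))
  have R_le: "energy (R n) \<le> energy \<eta> * contraction ^ n" for n
  proof (induction n)
    case (Suc n)
    have "energy (R (Suc n)) \<le> contraction * energy (R n)" unfolding R_Suc by (rule Z(5)[OF R])
    also have "\<dots> \<le> contraction * (energy \<eta> * contraction ^ n)"
      using contraction_bounds by (intro mult_left_mono Suc) simp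
    finally show ?case by (simp add: mult_ac)
  qed (simp add: R_0)
  have z_le: "(LINT t|lebesgue. (norm (Z (R n) t))\<^sup>2) \<le> (1 / \<beta> * energy \<eta>) * contraction ^ n" for n
  proof -
    have "(LINT t|lebesgue. (norm (Z (R n) t))\<^sup>2) \<le> 1 / \<beta> * energy (R n)" by (rule Z(3)[OF R])
    also have "\<dots> \<le> 1 / \<beta> * (energy \<eta> * contraction ^ n)"
      using \<beta> by (intro mult_left_mono R_le) simp
    finally show ?thesis by simp
  qed
  obtain w where "w \<in> L2 K lebesgue"
      "(\<forall>t. (\<forall>n. Z (R n) t = 0) \<longrightarrow> w t = 0) \<and>
       (\<forall>x\<in>L2 UNIV lebesgue. (\<lambda>n. L2_inner (Z (R n)) x) sums L2_inner w x)"
    by (rule bexE[OF L2_geometric_series[OF K Z(1)[OF R] z_le contraction_bounds]])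
  then have w: "w \<in> L2 K lebesgue" "\<And>t. (\<forall>n. Z (R n) t = 0) \<Longrightarrow> w t = 0"
      "\<And>x. x \<in> L2 UNIV lebesgue \<Longrightarrow> (\<lambda>n. L2_inner (Z (R n)) x) sums L2_inner w x"
    by blast+
  have "L2_inner w (e i) = \<eta> i" if i: "i \<in> \<Lambda>" for i
  proof -
    have "(\<lambda>n. energy \<eta> * contraction ^ n) \<longlonglongrightarrow> energy \<eta> * 0"
      using contraction_bounds by (intro tendsto_mult tendsto_const LIMSEQ_power_zero) simp
    then have majorant: "(\<lambda>n. energy \<eta> * contraction ^ n) \<longlonglongrightarrow> 0" by simp
    have le: "(norm (R n i))\<^sup>2 \<le> energy \<eta> * contraction ^ n" for n
    proof -
      have "(\<Sum>j\<in>{i}. (norm (R n j))\<^sup>2) \<le> energy (R n)"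
        using R[of n] i by (intro finite_sum_le_infsum) (auto simp: ell2_def)
      then show ?thesis using R_le[of n] by simp
    qed
    have "(\<lambda>n. (norm (R n i))\<^sup>2) \<longlonglongrightarrow> 0"
      by (rule tendsto_sandwich[OF always_eventually always_eventually tendsto_const majorant])
         (simp_all add: le)
    then have lim: "(\<lambda>n. R n i) \<longlonglongrightarrow> 0" by (simp add: tendsto_norm_zero_iff)
    have "(\<lambda>n. R n i - R (Suc n) i) sums (R 0 i - 0)" by (rule telescope_sums'[OF lim])
    moreover have "R n i - R (Suc n) i = L2_inner (Z (R n)) (e i)" for n by (simp add: R_Suc)
    moreover have "(\<lambda>n. L2_inner (Z (R n)) (e i)) sums L2_inner w (e i)"
      using e[OF i] L2_mono by (intro w(3)) blast
    ultimately show ?thesis by (simp add: R_0 sums_iff)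
  qed
  moreover have "w t = 0" if "t \<notin> E" for t using Z(2)[OF R that] by (intro w(2)) simp
  ultimately show ?thesis using w(1) by blast
qed

end

section \<open>Dilations, translations and wavelets\<close>

text \<open>
  The integral of \<open>\<bar>f - g\<bar>\<close> is zero, and the substitution formula only multiplies it by a constant.
\<close>

lemma AE_lebesgue_affine:
  fixes c b :: real and f g :: "real \<Rightarrow> complex"
  assumes "c \<noteq> 0" and f: "f \<in> borel_measurable lebesgue" and g: "g \<in> borel_measurable lebesgue"
    and "AE t in lebesgue. f t = g t"
  shows "AE t in lebesgue. f (b + c * t) = g (b + c * t)"
proof -
  have T: "(\<lambda>t. b + c * t) \<in> lebesgue \<rightarrow>\<^sub>M lebesgue"
    using lebesgue_affine_measurable[where c = "\<lambda>x::real. c" and t = b] \<open>c \<noteq> 0\<close> by simp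
  let ?d = "\<lambda>t. ennreal (norm (f t - g t))"
  have d: "?d \<in> borel_measurable lebesgue" using f g by measurable
  have "(\<integral>\<^sup>+t. ?d t \<partial>lebesgue) = 0"
    using assms(4) by (subst nn_integral_0_iff_AE[OF d]) (auto elim: eventually_mono)
  then have "ennreal \<bar>c\<bar> * (\<integral>\<^sup>+t. ?d (b + c * t) \<partial>lebesgue) = 0"
    by (subst nn_integral_real_affine_lebesgue[OF d \<open>c \<noteq> 0\<close>, symmetric])
  then have "(\<integral>\<^sup>+t. ?d (b + c * t) \<partial>lebesgue) = 0" using \<open>c \<noteq> 0\<close> by simp
  then show ?thesis
    by (subst (asm) nn_integral_0_iff_AE[OF measurable_compose[OF T d]]) (auto elim: eventually_mono)
qed

lemma L2_affine:
  fixes c b :: real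
  assumes "f \<in> L2 K lebesgue" "c \<noteq> 0"
  shows "(\<lambda>t. f (b + c * t)) \<in> L2 K lebesgue"
proof -
  have T: "(\<lambda>t. b + c * t) \<in> lebesgue \<rightarrow>\<^sub>M lebesgue"
    using lebesgue_affine_measurable[where c = "\<lambda>x::real. c" and t = b] \<open>c \<noteq> 0\<close> by simp
  show ?thesis
    using assms measurable_compose[OF T, of f] lebesgue_integrable_real_affine[of "\<lambda>t. (norm (f t))\<^sup>2" c b]
    by (auto simp: L2_def)
qed

text \<open>
  Under the substitution \<open>t = b + c * u\<close> the kernel of bandwidth \<open>\<omega>\<close>, times \<open>c\<close>, becomes the kernel of
  bandwidth \<open>c * \<omega>\<close>.
\<close>

lemma reproduced_by_sinc_affine:
  fixes b c :: real
  assumes f: "reproduced_by_sinc \<omega> f g" and c: "0 < c"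
  shows "reproduced_by_sinc (c * \<omega>) (\<lambda>t. f (b + c * t)) (\<lambda>z. g (of_real b + of_real c * z))"
  unfolding reproduced_by_sinc_def
proof (intro conjI allI)
  show "(\<lambda>t. f (b + c * t)) \<in> L2 UNIV lebesgue"
    using c by (intro L2_affine reproduced_by_sinc_L2[OF f]) simp
  have hol: "g holomorphic_on UNIV" by (rule reproduced_by_sinc_holomorphic[OF f])
  have "(g \<circ> (\<lambda>z. of_real b + of_real c * z)) holomorphic_on UNIV"
    by (rule holomorphic_on_compose_gen[OF _ hol]) (auto intro!: holomorphic_intros)
  then show "(\<lambda>z. g (of_real b + of_real c * z)) holomorphic_on UNIV" by (simp add: o_def)
  have "continuous_on UNIV (\<lambda>t. g (complex_of_real t))"
    by (intro continuous_on_compose2[OF holomorphic_on_imp_continuous_on[OF hol]] continuous_intros) auto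
  then have "(\<lambda>t. g (complex_of_real t)) \<in> borel_measurable lebesgue"
    by (intro borel_imp_lebesgue_measurable borel_measurable_continuous_onI)
  from AE_lebesgue_affine[OF _ L2_measurable[OF reproduced_by_sinc_L2[OF f]] this reproduced_by_sinc_AE[OF f], of c b]
  show "AE t in lebesgue. f (b + c * t) = g (of_real b + of_real c * of_real t)"
    using c by simp
  fix z
  have kernel: "of_real c * sinc_kernel \<omega> (of_real b + of_real c * z - of_real (b + c * u)) = sinc_kernel (c * \<omega>) (z - of_real u)" for u
    using sinc_kernel_scale[of c \<omega> "z - of_real u"] c by (simp add: algebra_simps)
  have "g (of_real b + of_real c * z) = (LINT t|lebesgue. f t * sinc_kernel \<omega> (of_real b + of_real c * z - of_real t))"
    by (rule reproduced_by_sinc_eq[OF f])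
  also have "\<dots> = \<bar>c\<bar> *\<^sub>R (LINT u|lebesgue. f (b + c * u) * sinc_kernel \<omega> (of_real b + of_real c * z - of_real (b + c * u)))"
    using c by (intro lebesgue_integral_real_affine) simp
  also have "\<dots> = (LINT u|lebesgue. of_real c * (f (b + c * u) * sinc_kernel \<omega> (of_real b + of_real c * z - of_real (b + c * u))))"
    using c by (simp add: scaleR_conv_of_real)
  also have "\<dots> = (LINT u|lebesgue. f (b + c * u) * sinc_kernel (c * \<omega>) (z - of_real u))"
    by (simp only: kernel[symmetric] mult.left_commute)
  finally show "g (of_real b + of_real c * z) = (LINT u|lebesgue. f (b + c * u) * sinc_kernel (c * \<omega>) (z - of_real u))" .
qed

lemma band_limited_reproduced_by_sinc:
  assumes "f \<in> L2 UNIV lebesgue" "has_fourier_transform f h" "ess_support h \<subseteq> {-\<rho>..\<rho>}" "0 \<le> \<rho>" "\<rho> \<le> \<omega>"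
  shows "reproduced_by_sinc \<omega> f (band_limited_extension \<rho> h)"
  unfolding reproduced_by_sinc_def
  using assms band_limited_inversion[OF assms(1-4)] sinc_kernel_reproduces[OF assms]
  by (auto simp: has_fourier_transform_def intro!: band_limited_extension_holomorphic)

lemma wavelet_eq: "wavelet \<psi> (j, k) = (\<lambda>t. of_real (2 powr (real_of_int j / 2)) * \<psi> (- real_of_int k + 2 powi j * t))"
  by (simp add: wavelet_def)

lemma wavelet_L2:
  assumes "scalar_field K" "\<psi> \<in> L2 K lebesgue"
  shows "wavelet \<psi> i \<in> L2 K lebesgue"
proof (cases i)
  case (Pair j k)
  have \<psi>: "(\<lambda>t. \<psi> (- real_of_int k + 2 powi j * t)) \<in> L2 K lebesgue"
    by (rule L2_affine[OF assms(2)]) simp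
  then have "(\<lambda>t. of_real (2 powr (real_of_int j / 2)) * \<psi> (- real_of_int k + 2 powi j * t)) \<in> L2 UNIV lebesgue"
    using L2_mono by (intro L2_cmult) blast
  then show ?thesis
    using \<psi> unfolding Pair wavelet_eq
    by (subst (asm) (2) L2_scalars_iff, subst L2_scalars_iff)
       (auto intro!: scalar_field_mult[OF assms(1)] scalar_field_of_real[OF assms(1)])
qed

text \<open>
  \<open>\<psi>\<close> is reproduced by every kernel of bandwidth at least \<open>\<rho>\<close>, in particular by the one of bandwidth
  \<open>2 powi (J - j) * \<rho>\<close>, which dilation by \<open>2 powi j\<close> turns into the bandwidth \<open>2 powi J * \<rho>\<close> common to
  all wavelets with \<open>j \<le> J\<close>.
\<close>

lemma wavelet_reproduced_by_sinc:
  assumes "\<psi> \<in> L2 UNIV lebesgue" "has_fourier_transform \<psi> h" "ess_support h \<subseteq> {-\<rho>..\<rho>}" "0 \<le> \<rho>"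
    and "j \<le> J"
  shows "\<exists>g. reproduced_by_sinc (2 powi J * \<rho>) (wavelet \<psi> (j, k)) g"
proof -
  define \<omega> where "\<omega> = 2 powi (J - j) * \<rho>"
  have "(1::real) \<le> 2 powi (J - j)" using assms(5) by (simp add: one_le_power_int)
  then have "1 * \<rho> \<le> \<omega>" unfolding \<omega>_def by (rule mult_right_mono) fact
  then have base: "reproduced_by_sinc \<omega> \<psi> (band_limited_extension \<rho> h)"
    using assms by (intro band_limited_reproduced_by_sinc) auto
  have "2 powi j * \<omega> = 2 powi J * \<rho>" unfolding \<omega>_def by (simp add: power_int_add[symmetric] flip: mult.assoc)
  then show ?thesis
    using reproduced_by_sinc_scale[OF reproduced_by_sinc_affine[OF base, of "2 powi j" "- real_of_int k"],
        of "of_real (2 powr (real_of_int j / 2))"]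
    unfolding wavelet_eq by (auto simp: zero_less_power_int)
qed

text \<open>
  Coefficients extended by zero are square-summable, and the partial sums of their series are
  eventually equal to the finite combination.
\<close>

lemma lower_riesz_bound_finite:
  assumes K: "scalar_field K" and e: "\<And>i. e i \<in> L2 K lebesgue" and riesz: "lower_riesz_bound K e \<gamma>"
    and F: "finite F" and c: "\<And>i. i \<in> F \<Longrightarrow> c i \<in> K"
  shows "(\<Sum>i\<in>F. (norm (c i))\<^sup>2) \<le> \<gamma> * (LINT t|lebesgue. (norm (\<Sum>i\<in>F. c i * e i t))\<^sup>2)"
proof -
  let ?c = "\<lambda>i. if i \<in> F then c i else 0"
  let ?s = "\<lambda>t. \<Sum>i\<in>F. c i * e i t"
  have c_sum: "((\<lambda>i. (norm (?c i))\<^sup>2) has_sum (\<Sum>i\<in>F. (norm (c i))\<^sup>2)) UNIV"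
    by (rule has_sum_finite_neutralI[OF F]) auto
  have c_ell2: "?c \<in> ell2 K UNIV"
    using c scalar_field_0[OF K] has_sum_imp_summable[OF c_sum] by (auto simp: ell2_def)
  have "?s \<in> L2 UNIV lebesgue" using e L2_mono by (intro L2_sum L2_cmult) blast
  then have s: "?s \<in> L2 K lebesgue"
    using c e by (subst L2_scalars_iff) (auto simp: L2_def intro!: scalar_field_sum[OF K] scalar_field_mult[OF K])
  have series: "has_L2_sum (\<lambda>i t. ?c i * e i t) ?s UNIV"
    unfolding has_L2_sum_def L2_tendsto_def
  proof (rule tendsto_eventually)
    have "(\<Sum>i\<in>G. ?c i * e i t) = ?s t" if "finite G" "F \<subseteq> G" for G t
      by (rule sum.mono_neutral_cong_right) (use that in auto)
    then show "\<forall>\<^sub>F G in finite_subsets_at_top UNIV.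
        (\<integral>\<^sup>+t. ennreal ((norm ((\<Sum>i\<in>G. ?c i * e i t) - ?s t))\<^sup>2) \<partial>lebesgue) = 0"
      unfolding eventually_finite_subsets_at_top using F by (intro exI[of _ F]) auto
  qed
  have "(\<Sum>\<^sub>\<infinity>i. (norm (?c i))\<^sup>2) \<le> \<gamma> * (L2_norm ?s)\<^sup>2"
    by (rule riesz[unfolded lower_riesz_bound_def, rule_format, OF c_ell2 s series])
  then show ?thesis unfolding infsumI[OF c_sum] L2_norm_sq .
qed

theorem proposition4p6:
  fixes K :: "complex set"
    and \<psi> \<psi>hat :: "real \<Rightarrow> complex"
    and \<rho> \<alpha> \<beta> \<gamma> :: real
    and A :: "real set"
    and J :: int
    and \<Lambda> :: "(int \<times> int) set"
  assumes "K = \<real> \<or> K = UNIV"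
    and "\<psi> \<in> L2 K lebesgue"
    and "0 < \<rho>"
    and "has_fourier_transform \<psi> \<psi>hat"
    and "ess_support \<psi>hat \<subseteq> {-\<rho>..\<rho>}"
    and "0 < \<alpha>" and "0 < \<beta>"
    and "frame_bounds K (wavelet \<psi>) \<alpha> \<beta>"
    and "0 < \<gamma>"
    and "lower_riesz_bound K (wavelet \<psi>) \<gamma>"
    and "A \<in> sets lebesgue"
    and "0 < emeasure lebesgue A" and "emeasure lebesgue A < \<infinity>"
    and "\<Lambda> = {(j, k). j \<le> J}"
  shows "\<forall>y\<in>L2 K (lebesgue_on A). \<forall>\<eta>\<in>ell2 K \<Lambda>. \<exists>x\<in>L2 K lebesgue.
           (AE t in lebesgue_on A. x t = y t) \<and>
           (\<forall>(j, k)\<in>\<Lambda>. L2_inner x (wavelet \<psi> (j, k)) = \<eta> (j, k))"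
proof (intro ballI)
  note [measurable] = \<open>A \<in> sets lebesgue\<close>
  have K: "scalar_field K" using assms(1) by (simp add: scalar_field_def)
  let ?e = "wavelet \<psi>"
  have wavelets: "?e i \<in> L2 K lebesgue" for i by (rule wavelet_L2[OF K assms(2)])
  define B where "B = 2 powi J * \<rho>"
  have B: "0 \<le> B" using assms(3) by (simp add: B_def)
  have \<psi>: "\<psi> \<in> L2 UNIV lebesgue" using assms(2) L2_mono by blast
  have "\<exists>g. reproduced_by_sinc B (?e i) g" if "i \<in> \<Lambda>" for i
    using that assms(14) wavelet_reproduced_by_sinc[OF \<psi> assms(4,5)] assms(3)
    unfolding B_def by (cases i) auto
  then obtain g where g: "\<And>i. i \<in> \<Lambda> \<Longrightarrow> reproduced_by_sinc B (?e i) (g i)" by metis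
  obtain \<delta> where \<delta>: "0 < \<delta>" and gap: "\<And>v g. reproduced_by_sinc B v g \<Longrightarrow>
      \<delta> * (LINT t|lebesgue. (norm (v t))\<^sup>2) \<le> (LINT t|lebesgue. indicator (- A) t * (norm (v t))\<^sup>2)"
    using band_limited_concentration_gap[OF B assms(11,13)] by blast
  \<comment> \<open>The quotient is the lower Riesz bound outside \<open>A\<close>; the maximum ensures \<open>1 \<le> \<kappa> * \<beta>\<close>.\<close>
  define \<kappa> where "\<kappa> = max (\<gamma> / \<delta>) (1 / \<beta>)"
  have frame: "(\<lambda>i. (norm (L2_inner x (?e i)))\<^sup>2) summable_on UNIV"
    "(\<Sum>\<^sub>\<infinity>i. (norm (L2_inner x (?e i)))\<^sup>2) \<le> \<beta> * (LINT t|lebesgue. (norm (x t))\<^sup>2)"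
    if "x \<in> L2 K lebesgue" for x
    using assms(8) that by (auto simp: frame_bounds_def L2_norm_sq)
  have frame_\<Lambda>: "(\<lambda>i. (norm (L2_inner x (?e i)))\<^sup>2) summable_on \<Lambda>" if "x \<in> L2 K lebesgue" for x
    by (rule summable_on_subset_banach[OF frame(1)[OF that]]) simp
  interpret restricted_riesz_family K ?e \<Lambda> "- A" \<beta> \<kappa>
  proof
    show "1 \<le> \<kappa> * \<beta>"
      using assms(7) by (simp add: \<kappa>_def max_def field_simps split: if_splits)
    show "0 < \<kappa>" using assms(7) by (simp add: \<kappa>_def less_max_iff_disj)
    show "- A \<in> sets lebesgue" using assms(11) by (simp add: Compl_in_sets_lebesgue)
    show "(\<Sum>\<^sub>\<infinity>i\<in>\<Lambda>. (norm (L2_inner x (?e i)))\<^sup>2) \<le> \<beta> * (LINT t|lebesgue. (norm (x t))\<^sup>2)"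
      if "x \<in> L2 K lebesgue" for x
      by (rule order_trans[OF infsum_mono_neutral[OF frame_\<Lambda>[OF that] frame(1)[OF that]] frame(2)[OF that]]) auto
    show "(\<Sum>i\<in>F. (norm (c i))\<^sup>2) \<le> \<kappa> * (LINT t|lebesgue. indicator (- A) t * (norm (\<Sum>i\<in>F. c i * ?e i t))\<^sup>2)"
      if F: "finite F" "F \<subseteq> \<Lambda>" and c: "\<And>i. i \<in> F \<Longrightarrow> c i \<in> K" for F c
    proof -
      let ?N = "LINT t|lebesgue. (norm (\<Sum>i\<in>F. c i * ?e i t))\<^sup>2"
      let ?G = "LINT t|lebesgue. indicator (- A) t * (norm (\<Sum>i\<in>F. c i * ?e i t))\<^sup>2"
      have "reproduced_by_sinc B (\<lambda>t. \<Sum>i\<in>F. c i * ?e i t) (\<lambda>z. \<Sum>i\<in>F. c i * g i z)"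
        using F by (intro reproduced_by_sinc_sum B reproduced_by_sinc_scale g) auto
      then have "\<delta> * ?N \<le> ?G" by (rule gap)
      then have "?N \<le> ?G / \<delta>" using \<delta> by (simp add: field_simps)
      have "(\<Sum>i\<in>F. (norm (c i))\<^sup>2) \<le> \<gamma> * ?N" by (rule lower_riesz_bound_finite[OF K wavelets assms(10) F(1) c])
      also have "\<dots> \<le> \<gamma> * (?G / \<delta>)" using \<open>?N \<le> ?G / \<delta>\<close> assms(9) by (intro mult_left_mono) auto
      also have "\<dots> = \<gamma> / \<delta> * ?G" by simp
      also have "\<dots> \<le> \<kappa> * ?G"
        by (intro mult_right_mono Bochner_Integration.integral_nonneg) (auto simp: \<kappa>_def)
      finally show ?thesis .
    qed
  qed (use K wavelets frame_\<Lambda> assms(7) in auto)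
  fix y \<eta> assume y: "y \<in> L2 K (lebesgue_on A)" and \<eta>: "\<eta> \<in> ell2 K \<Lambda>"
  define y0 where "y0 t = (if t \<in> A then y t else 0)" for t
  have y0: "y0 \<in> L2 K lebesgue"
  proof -
    have "y0 \<in> borel_measurable lebesgue"
      unfolding y0_def using y assms(11) by (subst borel_measurable_if) (auto simp: L2_def)
    moreover have "integrable lebesgue (\<lambda>t. if t \<in> A then (norm (y t))\<^sup>2 else 0)"
      by (rule Lebesgue_Measure.integrable_restrict_UNIV[THEN iffD2, OF assms(11) L2_integrable_norm_sq[OF y]])
    moreover have "(\<lambda>t. (norm (y0 t))\<^sup>2) = (\<lambda>t. if t \<in> A then (norm (y t))\<^sup>2 else 0)"
      by (auto simp: y0_def)
    ultimately show ?thesis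
      using y scalar_field_0[OF K] by (auto simp: L2_def y0_def)
  qed
  have "(\<lambda>i. \<eta> i - L2_inner y0 (?e i)) \<in> ell2 K \<Lambda>"
  proof -
    have "(\<lambda>i. 2 * (norm (\<eta> i))\<^sup>2 + 2 * (norm (- L2_inner y0 (?e i)))\<^sup>2) summable_on \<Lambda>"
      using \<eta> frame_\<Lambda>[OF y0] by (intro summable_on_add summable_on_cmult_right) (auto simp: ell2_def)
    then have "(\<lambda>i. (norm (\<eta> i + - L2_inner y0 (?e i)))\<^sup>2) summable_on \<Lambda>"
      by (rule summable_on_comparison_test[OF _ norm_add_sq_le]) simp
    then show ?thesis
      using \<eta> L2_inner_scalar[OF K y0 wavelets] by (auto simp: ell2_def intro!: scalar_field_diff[OF K])
  qed
  then obtain w where "w \<in> L2 K lebesgue"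
      "(\<forall>t. t \<notin> - A \<longrightarrow> w t = 0) \<and> (\<forall>i\<in>\<Lambda>. L2_inner w (?e i) = \<eta> i - L2_inner y0 (?e i))"
    by (rule bexE[OF moment_problem_solvable])
  then have w: "w \<in> L2 K lebesgue" "\<forall>t. t \<notin> - A \<longrightarrow> w t = 0"
      "\<forall>i\<in>\<Lambda>. L2_inner w (?e i) = \<eta> i - L2_inner y0 (?e i)"
    by blast+
  let ?x = "\<lambda>t. y0 t + w t"
  have y0': "y0 \<in> L2 UNIV lebesgue" and w': "w \<in> L2 UNIV lebesgue" and e': "?e i \<in> L2 UNIV lebesgue" for i
    by (rule subsetD[OF L2_mono], rule y0 w(1) wavelets)+
  have "?x t \<in> K" for t
    using y0 w(1) by (intro scalar_field_add[OF K]) (auto simp: L2_def)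
  then have "?x \<in> L2 K lebesgue"
    using L2_add[OF y0' w'] by (subst L2_scalars_iff) simp
  moreover have "AE t in lebesgue_on A. ?x t = y t"
    using w(2) by (intro AE_I2) (simp add: y0_def)
  moreover have "L2_inner ?x (?e i) = \<eta> i" if "i \<in> \<Lambda>" for i
  proof -
    have "L2_inner ?x (?e i) = L2_inner y0 (?e i) + L2_inner w (?e i)"
      unfolding L2_inner_def distrib_right
      by (rule Bochner_Integration.integral_add[OF L2_inner_integrable[OF y0' e'] L2_inner_integrable[OF w' e']])
    then show ?thesis using w(3) that by simp
  qed
  ultimately show "\<exists>x\<in>L2 K lebesgue. (AE t in lebesgue_on A. x t = y t) \<and>
      (\<forall>(j, k)\<in>\<Lambda>. L2_inner x (?e (j, k)) = \<eta> (j, k))"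
    by (intro bexI[of _ ?x] conjI) (simp_all add: case_prod_beta)
qed

end
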